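(* Let $P,Q\in D_1$ be a normalized solution of the string equation $[Q,P]=1$ with $\operatorname{ord}(P)=p=nd$, $\operatorname{ord}(Q)=\mathbf{ord}(Q)=q=md$, where $(m,n)=1$, having a head-chopping sequence $Q_i=F_i(P,Q)$, $i=0,\ldots,I$, with $\operatorname{ord}(Q_i)=\mathbf{ord}(Q_i)$ for all $i$, $SeqGCD_I(P,Q)=1$ and $SeqGCD_{I-1}(P,Q)>1$. Let $P',Q'\in D_1$ be the normalized pair of commuting operators corresponding to $(P,Q)$. Let $*(P),-*(Q)\in D_1$ be the adjoint normalized solution of the string equation. Then the normalized pair of commuting operators corresponding to $( *(P),-*(Q))$ is $( *(P'),-*(Q'))$.
   Context: $K=\mathbb{C}$ (or any algebraically closed field of characteristic zero). $D_1=K[[x]][\partial]$, $\operatorname{ord}$ = degree in $\partial$. $*:D_1\to D_1$ is the anti-automorphism with $*(x)=x$, $*(\partial)=-\partial$. $\hat D_1^{sym}$ is the ring of formal series $P=\sum_{k\ge0}a_k\partial^k$, $a_k\in K[[x]]$, with $\mathbf{ord}(P):=\sup_k\{k-v(a_k)\}<\infty$ ($v$ the $x$-adic valuation). For $P=\sum\alpha_{k,i}x^i\partial^k$, $P_m=\sum_{k-i=m}\alpha_{k,i}x^i\partial^k$ is its $m$-th homogeneous component and $\sigma(P)=P_{\mathbf{ord}(P)}$. A monic Schur operator for $P\in D_1$ with $\operatorname{ord}(P)=p$, $\sigma(P)=\partial^p$, is an invertible $S\in\hat D_1^{sym}$ with $\mathbf{ord}(S)=0$, $S_0=1$, $S^{-1}PS=\partial^p$.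 A pair $P,Q\in D_1$ with $[Q,P]=1$ (resp. $[Q,P]=0$) is a normalized solution of the string equation (resp. a normalized pair of commuting operators) if $P$ is monic and normalized: $P=\partial^p+a_{p-2}\partial^{p-2}+\ldots+a_0$. Convention: $(m,n)=1$ means coprime and $m,n>1$. Head-chopping sequence: $Q_0=Q$, $Q_{i+1}=Q_i^{n_i}-\varepsilon_i^{n_i}P^{m_i}$ ($n_i,m_i\in\mathbb{N}$, $\varepsilon_i\in K$, $0\le i<I$) with $\mathbf{ord}(Q_{i+1})<\mathbf{ord}(Q_i^{n_i})$; $Q_i=F_i(P,Q)$ where $F_0=Y$, $F_{i+1}=F_i^{n_i}-\varepsilon_i^{n_i}X^{m_i}$. $SeqGCD_i(P,Q)=GCD(\operatorname{ord}(P),\operatorname{ord}(Q_0),\ldots,\operatorname{ord}(Q_i))$. Correspondence: to a normalized solution $(P,Q)$ of the string equation $[Q,P]=1$ with $\operatorname{ord}(P)=p=nd$, $\operatorname{ord}(Q)=\mathbf{ord}(Q)=q=md$, $(m,n)=1$, having a head-chopping sequence $Q_i=F_i(P,Q)$, $i=0,\ldots,I$, with $\operatorname{ord}(Q_i)=\mathbf{ord}(Q_i)$ for all $i$, $SeqGCD_I(P,Q)=1$ and $SeqGCD_{I-1}(P,Q)>1$, there corresponds a unique normalized pair of commuting operators $(P',Q')$ with $\operatorname{ord}(P')=p$, $\operatorname{ord}(Q')=q$, $\operatorname{rk}K[P',Q']=GCD\{\operatorname{ord}(L):L\in K[P',Q']\}=1$, characterised as follows: there are monic Schur operators $S$ for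 $P$ and $S'$ for $P'$ such that, with $\tilde Q=S^{-1}QS$, one has $S'^{-1}Q'S'=\tilde Q-\tilde Q_{-p}$. It is independent of the choice of $S$.
   Formalization: For odd p, *(P) has leading term −∂^p and is not normalized, so the claim is undefined as written; there it is stated and proved for (−*(P), *(Q)) with corresponding pair (−*(P'), *(Q')). For even p it is as written. *)

theory Defs
  imports "HOL-Computational_Algebra.Polynomial" "HOL-Computational_Algebra.Formal_Power_Series"
    "HOL-Library.Extended_Real"
begin

unbundle fps_syntax

section \<open>Auxiliary facts on formal power series\<close>

lemma fps_sums_nth:
  fixes f :: "nat \<Rightarrow> 'a::comm_ring_1 fps"
  assumes "\<And>i. \<exists>N. \<forall>k\<ge>N. f k $ i = 0"
  shows "summable f" and "\<And>i N. (\<forall>k\<ge>N. f k $ i = 0) \<Longrightarrow> suminf f $ i = (\<Sum>k<N. f k $ i)"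
proof -
  define S where "S = Abs_fps (\<lambda>i. \<Sum>k<(LEAST N. \<forall>k\<ge>N. f k $ i = 0). f k $ i)"
  have S: "S $ i = (\<Sum>k<N. f k $ i)" if N: "\<forall>k\<ge>N. f k $ i = 0" for i N
  proof -
    define L where "L = (LEAST N. \<forall>k\<ge>N. f k $ i = 0)"
    have 1: "\<forall>k\<ge>L. f k $ i = 0" unfolding L_def by (rule LeastI) (rule N)
    have 2: "L \<le> N" unfolding L_def by (rule Least_le) (rule N)
    have "(\<Sum>k<L. f k $ i) = (\<Sum>k<N. f k $ i)"
      by (rule sum.mono_neutral_left) (use 1 2 in auto)
    then show ?thesis by (simp add: S_def L_def)
  qed
  have "f sums S"
    unfolding sums_def
  proof (rule tendsto_fpsI)
    fix i
    obtain N where N: "\<forall>k\<ge>N. f k $ i = 0" using assms by blast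
    show "\<forall>\<^sub>F n in sequentially. (\<Sum>k<n. f k) $ i = S $ i"
      using eventually_ge_at_top[of N]
    proof eventually_elim
      case (elim n)
      then have "\<forall>k\<ge>n. f k $ i = 0" using N by auto
      then show ?case by (simp add: S fps_sum_nth)
    qed
  qed
  then show "summable f" and "\<And>i N. (\<forall>k\<ge>N. f k $ i = 0) \<Longrightarrow> suminf f $ i = (\<Sum>k<N. f k $ i)"
    using S by (auto simp: sums_iff)
qed

lemma fps_deriv_funpow_nth_eq_0:
  fixes f :: "'a::comm_ring_1 fps"
  assumes "f $ (i + t) = 0"
  shows "(fps_deriv ^^ t) f $ i = 0"
  using assms
proof (induction t arbitrary: i)
  case (Suc t)
  have "(fps_deriv ^^ t) f $ (i + 1) = 0" by (rule Suc.IH) (use Suc.prems in simp)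
  then show ?case by simp
qed simp

lemma fps_deriv_funpow_sum:
  fixes f :: "'b \<Rightarrow> 'a::comm_ring_1 fps"
  shows "(fps_deriv ^^ t) (\<Sum>x\<in>A. f x) = (\<Sum>x\<in>A. (fps_deriv ^^ t) (f x))"
  by (induction t) (simp_all add: fps_deriv_sum)

lemma fps_deriv_funpow_add:
  fixes f :: "'a::comm_ring_1 fps"
  shows "(fps_deriv ^^ t) (f + g) = (fps_deriv ^^ t) f + (fps_deriv ^^ t) g"
  by (induction t) simp_all

lemma fps_deriv_funpow_uminus:
  fixes f :: "'a::comm_ring_1 fps"
  shows "(fps_deriv ^^ t) (- f) = - (fps_deriv ^^ t) f"
  by (induction t) simp_all

lemma fps_deriv_funpow_0: "(fps_deriv ^^ t) (0 :: 'a::comm_ring_1 fps) = 0"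
  by (induction t) simp_all

lemma fps_deriv_funpow_1: "(fps_deriv ^^ t) (1 :: 'a::comm_ring_1 fps) = (if t = 0 then 1 else 0)"
  by (induction t) auto

lemma fps_deriv_funpow_mult:
  fixes f g :: "'a::comm_ring_1 fps"
  shows "(fps_deriv ^^ k) (f * g) =
    (\<Sum>t\<le>k. of_nat (k choose t) * ((fps_deriv ^^ t) f * (fps_deriv ^^ (k - t)) g))"
proof (induction k)
  case (Suc k)
  let ?F = "\<lambda>t. (fps_deriv ^^ t) f" and ?G = "\<lambda>t. (fps_deriv ^^ t) g"
  have "(fps_deriv ^^ Suc k) (f * g) =
    (\<Sum>t\<le>k. of_nat (k choose t) * (?F (Suc t) * ?G (k - t) + ?F t * ?G (Suc (k - t))))"
    by (simp add: Suc.IH fps_deriv_sum fps_of_nat[symmetric] algebra_simps)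
  also have "\<dots> = (\<Sum>t\<le>k. of_nat (k choose t) * (?F (Suc t) * ?G (k - t))) +
      (\<Sum>t\<le>k. of_nat (k choose t) * (?F t * ?G (Suc k - t)))"
    by (simp only: distrib_left sum.distrib) (intro arg_cong2[of _ _ _ _ "(+)"] sum.cong refl; simp add: Suc_diff_le)
  also have "(\<Sum>t\<le>k. of_nat (k choose t) * (?F t * ?G (Suc k - t))) =
      (\<Sum>t\<le>Suc k. of_nat (k choose t) * (?F t * ?G (Suc k - t)))"
    by (simp add: binomial_eq_0)
  also have "\<dots> = ?F 0 * ?G (Suc k) + (\<Sum>t\<le>k. of_nat (k choose Suc t) * (?F (Suc t) * ?G (k - t)))"
    by (subst sum.atMost_Suc_shift) simp
  also have "(\<Sum>t\<le>k. of_nat (k choose t) * (?F (Suc t) * ?G (k - t))) + \<dots> =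
     ?F 0 * ?G (Suc k) + (\<Sum>t\<le>k. of_nat (Suc k choose Suc t) * (?F (Suc t) * ?G (k - t)))"
    by (simp add: sum.distrib algebra_simps)
  also have "\<dots> = (\<Sum>t\<le>Suc k. of_nat (Suc k choose t) * (?F t * ?G (Suc k - t)))"
    by (subst sum.atMost_Suc_shift) simp
  finally show ?case .
qed simp

lemma fps_mult_nth_eq_0:
  fixes f :: "'a::comm_ring_1 fps"
  assumes "\<And>j. j \<le> i \<Longrightarrow> f $ j = 0"
  shows "(f * g) $ i = 0"
  using assms by (simp add: fps_mult_nth)

lemma fps_mult_nth_eq_0':
  fixes f :: "'a::comm_ring_1 fps"
  assumes "\<And>j. j \<le> i \<Longrightarrow> g $ j = 0"
  shows "(f * g) $ i = 0"
  using assms by (simp add: fps_mult_nth)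

lemma fps_mult_nth_cong:
  fixes f :: "'a::comm_ring_1 fps"
  assumes "\<And>j. j \<le> i \<Longrightarrow> f $ j = f' $ j" "\<And>j. j \<le> i \<Longrightarrow> g $ j = g' $ j"
  shows "(f * g) $ i = (f' * g') $ i"
  unfolding fps_mult_nth by (rule sum.cong) (use assms in auto)


section \<open>The ring of formal differential operators of bounded order\<close>

text \<open>
  An operator $\sum_k a_k \partial^k$ is represented by its sequence of coefficients $k \mapsto a_k$,
  written to the left of the powers of $\partial$; the membership condition says
  $\sup_k (k - v(a_k)) < \infty$, where \<open>subdegree\<close> is the $x$-adic valuation.
\<close>

typedef (overloaded) 'a dsym =
  "{a :: nat \<Rightarrow> 'a::zero fps. \<exists>M. \<forall>k. a k \<noteq> 0 \<longrightarrow> k \<le> subdegree (a k) + M}"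
  morphisms dcoeff Abs_dsym
  by (rule exI[of _ "\<lambda>_. 0"]) simp

setup_lifting type_definition_dsym

lemma dsym_bound_iff:
  "(\<forall>k. a k \<noteq> 0 \<longrightarrow> k \<le> subdegree (a k) + M) \<longleftrightarrow> (\<forall>k i. a k $ i \<noteq> 0 \<longrightarrow> k \<le> i + M)"
proof (intro iffI allI impI)
  fix k i assume *: "\<forall>k. a k \<noteq> 0 \<longrightarrow> k \<le> subdegree (a k) + M" "a k $ i \<noteq> 0"
  then have "a k \<noteq> 0" "subdegree (a k) \<le> i" by (auto intro: subdegree_leI)
  then show "k \<le> i + M" using * by (metis add_le_mono1 order_trans)
next
  fix k assume *: "\<forall>k i. a k $ i \<noteq> 0 \<longrightarrow> k \<le> i + M" "a k \<noteq> 0"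
  then have "a k $ subdegree (a k) \<noteq> 0" by simp
  then show "k \<le> subdegree (a k) + M" using * by blast
qed

lemma dsym_mem_iff:
  "(\<exists>M. \<forall>k. a k \<noteq> 0 \<longrightarrow> k \<le> subdegree (a k) + M) \<longleftrightarrow> (\<exists>M. \<forall>k i. a k $ i \<noteq> 0 \<longrightarrow> k \<le> i + M)"
  by (simp add: dsym_bound_iff)

lemma dcoeff_bound: "\<exists>M. \<forall>k i. dcoeff P k $ i \<noteq> 0 \<longrightarrow> k \<le> i + M"
  using dcoeff[of P] dsym_mem_iff[of "dcoeff P"] by simp

lemma dsym_eqI: "(\<And>k i. dcoeff P k $ i = dcoeff Q k $ i) \<Longrightarrow> P = Q"
  by (simp add: dcoeff_inject[symmetric] fun_eq_iff fps_eq_iff)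

text \<open>
  Coefficient of $\partial^n$ in the product, from
  $a_k \partial^k \cdot b_l \partial^l = \sum_{t \le k} \binom{k}{t} a_k b_l^{(t)} \partial^{k-t+l}$,
  with $l = n + t - k$. The outer series converges $x$-adically.
\<close>

definition dmult_coeff :: "(nat \<Rightarrow> 'a fps) \<Rightarrow> (nat \<Rightarrow> 'a fps) \<Rightarrow> nat \<Rightarrow> 'a::comm_ring_1 fps" where
  "dmult_coeff a b n = (\<Sum>k. \<Sum>t\<in>{t. t \<le> k \<and> k \<le> n + t}.
      of_nat (k choose t) * a k * (fps_deriv ^^ t) (b (n + t - k)))"

lemma dmult_coeff_nth:
  assumes M: "\<forall>k i. a k $ i \<noteq> 0 \<longrightarrow> k \<le> i + M" and K: "i + M < K"
  shows "dmult_coeff a b n $ i = (\<Sum>k<K. \<Sum>t\<in>{t. t \<le> k \<and> k \<le> n + t}.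
      of_nat (k choose t) * a k * (fps_deriv ^^ t) (b (n + t - k))) $ i"
proof -
  define f where "f = (\<lambda>k. \<Sum>t\<in>{t. t \<le> k \<and> k \<le> n + t}.
      of_nat (k choose t) * a k * (fps_deriv ^^ t) (b (n + t - k)))"
  have z: "f k $ j = 0" if "k > j + M" for k j
    unfolding f_def fps_sum_nth
  proof (rule sum.neutral, rule ballI)
    fix t
    have "a k $ j' = 0" if "j' \<le> j" for j' using M \<open>k > j + M\<close> that by force
    then have "(a k * (fps_deriv ^^ t) (b (n + t - k))) $ j = 0"
      by (rule fps_mult_nth_eq_0)
    then show "(of_nat (k choose t) * a k * (fps_deriv ^^ t) (b (n + t - k))) $ j = 0"
      by (simp add: mult.assoc fps_of_nat[symmetric])
  qed
  have "suminf f $ i = (\<Sum>k<K. f k $ i)"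
  proof (rule fps_sums_nth(2))
    show "\<exists>N. \<forall>k\<ge>N. f k $ j = 0" for j using z by (metis Suc_le_eq)
    show "\<forall>k\<ge>K. f k $ i = 0" using z K by auto
  qed
  then show ?thesis by (simp add: dmult_coeff_def f_def fps_sum_nth)
qed

lemma dmult_coeff_bounded:
  fixes a b :: "nat \<Rightarrow> 'a::comm_ring_1 fps"
  assumes M: "\<forall>k i. a k $ i \<noteq> 0 \<longrightarrow> k \<le> i + M" and L: "\<forall>k i. b k $ i \<noteq> 0 \<longrightarrow> k \<le> i + L"
  shows "\<forall>n i. dmult_coeff a b n $ i \<noteq> 0 \<longrightarrow> n \<le> i + (M + L)"
proof (intro allI impI, rule ccontr)
  fix n i assume nz: "dmult_coeff a b n $ i \<noteq> 0" and "\<not> n \<le> i + (M + L)"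
  then have n: "n > i + M + L" by simp
  have "dmult_coeff a b n $ i = 0"
    unfolding dmult_coeff_nth[OF M lessI] fps_sum_nth
  proof (intro sum.neutral ballI)
    fix k t assume "t \<in> {t. t \<le> k \<and> k \<le> n + t}"
    then have t: "t \<le> k" "k \<le> n + t" by auto
    have "(a k * (fps_deriv ^^ t) (b (n + t - k))) $ i = 0"
      unfolding fps_mult_nth
    proof (intro sum.neutral ballI)
      fix j assume j: "j \<in> {0..i}"
      show "a k $ j * (fps_deriv ^^ t) (b (n + t - k)) $ (i - j) = 0"
      proof (cases "a k $ j = 0")
        case False
        then have "k \<le> j + M" using M by blast
        then have "\<not> n + t - k \<le> i - j + t + L" using n j t by auto
        then have "b (n + t - k) $ (i - j + t) = 0" using L by blast
        then show ?thesis by (simp add: fps_deriv_funpow_nth_eq_0)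
      qed simp
    qed
    then show "(of_nat (k choose t) * a k * (fps_deriv ^^ t) (b (n + t - k))) $ i = 0"
      by (simp add: mult.assoc fps_of_nat[symmetric])
  qed
  then show False using nz by simp
qed

instantiation dsym :: (comm_ring_1) "{zero, one, plus, minus, uminus, times}"
begin

lift_definition zero_dsym :: "'a dsym" is "\<lambda>_. 0" by simp

lift_definition one_dsym :: "'a dsym" is "\<lambda>k. if k = 0 then 1 else 0"
  by (rule exI[of _ 0]) simp

lift_definition uminus_dsym :: "'a dsym \<Rightarrow> 'a dsym" is "\<lambda>a k. - a k" by simp

lift_definition plus_dsym :: "'a dsym \<Rightarrow> 'a dsym \<Rightarrow> 'a dsym" is "\<lambda>a b k. a k + b k"
proof -
  fix a b :: "nat \<Rightarrow> 'a fps"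
  assume "\<exists>M. \<forall>k. a k \<noteq> 0 \<longrightarrow> k \<le> subdegree (a k) + M" "\<exists>M. \<forall>k. b k \<noteq> 0 \<longrightarrow> k \<le> subdegree (b k) + M"
  then obtain M L where bnd: "\<forall>k i. a k $ i \<noteq> 0 \<longrightarrow> k \<le> i + M" "\<forall>k i. b k $ i \<noteq> 0 \<longrightarrow> k \<le> i + L"
    unfolding dsym_mem_iff by blast
  have "k \<le> i + (M + L)" if "(a k + b k) $ i \<noteq> 0" for k i
  proof -
    have "a k $ i \<noteq> 0 \<or> b k $ i \<noteq> 0" using that by auto
    then have "k \<le> i + M \<or> k \<le> i + L" using bnd by blast
    then show ?thesis by auto
  qed
  then show "\<exists>M. \<forall>k. a k + b k \<noteq> 0 \<longrightarrow> k \<le> subdegree (a k + b k) + M"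
    unfolding dsym_mem_iff by blast
qed

definition minus_dsym :: "'a dsym \<Rightarrow> 'a dsym \<Rightarrow> 'a dsym" where "minus_dsym P Q = P + - Q"

lift_definition times_dsym :: "'a dsym \<Rightarrow> 'a dsym \<Rightarrow> 'a dsym" is dmult_coeff
  unfolding dsym_mem_iff using dmult_coeff_bounded by blast

instance ..

end

instance dsym :: (comm_ring_1) ab_group_add
  by standard (transfer; simp add: fun_eq_iff minus_dsym_def algebra_simps)+

subsection \<open>The action on power series, and associativity\<close>

definition dact :: "'a::comm_ring_1 dsym \<Rightarrow> 'a fps \<Rightarrow> 'a fps" where
  "dact P f = (\<Sum>k. dcoeff P k * (fps_deriv ^^ k) f)"

lemma dact_nth:
  assumes M: "\<forall>k i. dcoeff P k $ i \<noteq> 0 \<longrightarrow> k \<le> i + M" and K: "i + M < K"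
  shows "dact P f $ i = (\<Sum>k<K. dcoeff P k * (fps_deriv ^^ k) f) $ i"
proof -
  have z: "(dcoeff P k * (fps_deriv ^^ k) f) $ j = 0" if "k > j + M" for k j
    by (rule fps_mult_nth_eq_0) (use M that in force)
  have "dact P f $ i = (\<Sum>k<K. (dcoeff P k * (fps_deriv ^^ k) f) $ i)"
    unfolding dact_def
  proof (rule fps_sums_nth(2))
    show "\<exists>N. \<forall>k\<ge>N. (dcoeff P k * (fps_deriv ^^ k) f) $ j = 0" for j
      using z by (metis Suc_le_eq)
    show "\<forall>k\<ge>K. (dcoeff P k * (fps_deriv ^^ k) f) $ i = 0" using z K by auto
  qed
  then show ?thesis by (simp add: fps_sum_nth)
qed

lemma fps_deriv_funpow_nth_cong:
  fixes f :: "'a::comm_ring_1 fps"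
  assumes "f $ (i + t) = g $ (i + t)"
  shows "(fps_deriv ^^ t) f $ i = (fps_deriv ^^ t) g $ i"
proof -
  have "(fps_deriv ^^ t) (f + - g) $ i = 0" by (rule fps_deriv_funpow_nth_eq_0) (use assms in simp)
  then show ?thesis unfolding fps_deriv_funpow_add fps_deriv_funpow_uminus by simp
qed

lemma dact_mult: "dact (P * Q) f = dact P (dact Q f)"
proof (rule fps_ext)
  fix i
  define a b where "a = dcoeff P" and "b = dcoeff Q"
  obtain M L where M: "\<forall>k i. a k $ i \<noteq> 0 \<longrightarrow> k \<le> i + M" and L: "\<forall>k i. b k $ i \<noteq> 0 \<longrightarrow> k \<le> i + L"
    using dcoeff_bound a_def b_def by metis
  have PQ: "dcoeff (P * Q) = dmult_coeff a b" unfolding a_def b_def by transfer simp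
  define K where "K = Suc (i + M)"
  define N where "N = Suc (i + K + M + L)"
  define g where "g k t l = of_nat (k choose t) * a k * ((fps_deriv ^^ t) (b l) * (fps_deriv ^^ (k - t + l)) f)"
    for k t l
  have gz: "g k t l $ i = 0" if "t \<le> k" "k < K" "N \<le> l + K" "i + K + L < l" for k t l
  proof -
    have "((fps_deriv ^^ t) (b l) * (fps_deriv ^^ (k - t + l)) f) $ j = 0" if "j \<le> i" for j
    proof (rule fps_mult_nth_eq_0)
      fix j' assume "j' \<le> j"
      then have "\<not> l \<le> (j' + t) + L" using that \<open>t \<le> k\<close> \<open>k < K\<close> \<open>i + K + L < l\<close> by simp
      then show "(fps_deriv ^^ t) (b l) $ j' = 0"
        using L by (intro fps_deriv_funpow_nth_eq_0) blast
    qed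
    then show ?thesis unfolding g_def by (rule fps_mult_nth_eq_0')
  qed
  define N1 where "N1 = N + K"
  have bd: "\<forall>n i. dcoeff (P * Q) n $ i \<noteq> 0 \<longrightarrow> n \<le> i + (M + L)"
    unfolding PQ by (rule dmult_coeff_bounded[OF M L])
  have "dact (P * Q) f $ i = (\<Sum>n<N1. dmult_coeff a b n * (fps_deriv ^^ n) f) $ i"
    unfolding PQ[symmetric] by (rule dact_nth[OF bd]) (simp add: N1_def N_def)
  also have "\<dots> = (\<Sum>n<N1. ((\<Sum>k<K. \<Sum>t\<in>{t. t \<le> k \<and> k \<le> n + t}.
      of_nat (k choose t) * a k * (fps_deriv ^^ t) (b (n + t - k))) * (fps_deriv ^^ n) f) $ i)"
    unfolding fps_sum_nth
  proof (rule sum.cong[OF refl], rule fps_mult_nth_cong)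
    fix n j assume "j \<le> i"
    then show "dmult_coeff a b n $ j = (\<Sum>k<K. \<Sum>t\<in>{t. t \<le> k \<and> k \<le> n + t}.
      of_nat (k choose t) * a k * (fps_deriv ^^ t) (b (n + t - k))) $ j"
      by (intro dmult_coeff_nth[OF M]) (simp add: K_def)
  qed simp
  also have "\<dots> = (\<Sum>n<N1. \<Sum>k<K. \<Sum>t\<in>{t. t \<le> k \<and> k \<le> n + t}. g k t (n + t - k) $ i)"
    unfolding fps_sum_nth[symmetric] sum_distrib_right
    by (intro arg_cong[of _ _ "\<lambda>h. h $ i"] sum.cong refl) (auto simp: g_def mult.assoc)
  also have "\<dots> = (\<Sum>k<K. \<Sum>n<N1. \<Sum>t\<in>{t. t \<le> k \<and> k \<le> n + t}. g k t (n + t - k) $ i)"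
    by (rule sum.swap)
  also have "\<dots> = (\<Sum>k<K. \<Sum>t\<le>k. \<Sum>l<N. g k t l $ i)"
  proof (rule sum.cong[OF refl])
    fix k assume "k \<in> {..<K}"
    then have k: "k < K" by simp
    have "(\<Sum>n<N1. \<Sum>t\<in>{t. t \<le> k \<and> k \<le> n + t}. g k t (n + t - k) $ i) =
        (\<Sum>n<N1. \<Sum>t\<le>k. if k \<le> n + t then g k t (n + t - k) $ i else 0)"
    proof (rule sum.cong[OF refl])
      fix n
      have eq: "{t. t \<le> k \<and> k \<le> n + t} = {t \<in> {..k}. k \<le> n + t}" by auto
      show "(\<Sum>t\<in>{t. t \<le> k \<and> k \<le> n + t}. g k t (n + t - k) $ i) =
        (\<Sum>t\<le>k. if k \<le> n + t then g k t (n + t - k) $ i else 0)"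
        unfolding eq by (rule sum.inter_filter) simp
    qed
    also have "\<dots> = (\<Sum>t\<le>k. \<Sum>n<N1. if k \<le> n + t then g k t (n + t - k) $ i else 0)"
      by (rule sum.swap)
    also have "\<dots> = (\<Sum>t\<le>k. \<Sum>l<N. g k t l $ i)"
    proof (rule sum.cong[OF refl])
      fix t assume "t \<in> {..k}"
      then have t: "t \<le> k" by simp
      have "(\<Sum>n<N1. if k \<le> n + t then g k t (n + t - k) $ i else 0) =
        (\<Sum>n\<in>{n\<in>{..<N1}. k \<le> n + t}. g k t (n + t - k) $ i)"
        by (rule sum.inter_filter[symmetric]) simp
      also have "\<dots> = (\<Sum>l\<in>{..<N1 + t - k}. g k t l $ i)"
        by (rule sum.reindex_bij_witness[of _ "\<lambda>l. l + k - t" "\<lambda>n. n + t - k"]) (use t in auto)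
      also have "\<dots> = (\<Sum>l<N. g k t l $ i)"
      proof (rule sum.mono_neutral_right)
        show "{..<N} \<subseteq> {..<N1 + t - k}" using k t by (auto simp: N1_def)
        show "\<forall>l\<in>{..<N1 + t - k} - {..<N}. g k t l $ i = 0"
          using gz[OF t k] by (auto simp: N_def)
      qed simp
      finally show "(\<Sum>n<N1. if k \<le> n + t then g k t (n + t - k) $ i else 0) = (\<Sum>l<N. g k t l $ i)" .
    qed
    finally show "(\<Sum>n<N1. \<Sum>t\<in>{t. t \<le> k \<and> k \<le> n + t}. g k t (n + t - k) $ i) =
      (\<Sum>t\<le>k. \<Sum>l<N. g k t l $ i)" .
  qed
  also have "\<dots> = (\<Sum>k<K. (a k * (fps_deriv ^^ k) (\<Sum>l<N. b l * (fps_deriv ^^ l) f)) $ i)"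
  proof (rule sum.cong[OF refl])
    fix k
    have "a k * (fps_deriv ^^ k) (\<Sum>l<N. b l * (fps_deriv ^^ l) f) =
      (\<Sum>l<N. \<Sum>t\<le>k. g k t l)"
      unfolding fps_deriv_funpow_sum fps_deriv_funpow_mult sum_distrib_left g_def
      by (intro sum.cong refl) (simp only: funpow_add o_apply mult_ac)
    also have "\<dots> = (\<Sum>t\<le>k. \<Sum>l<N. g k t l)" by (rule sum.swap)
    finally show "(\<Sum>t\<le>k. \<Sum>l<N. g k t l $ i) =
      (a k * (fps_deriv ^^ k) (\<Sum>l<N. b l * (fps_deriv ^^ l) f)) $ i"
      by (simp add: fps_sum_nth)
  qed
  also have "\<dots> = (\<Sum>k<K. (a k * (fps_deriv ^^ k) (dact Q f)) $ i)"
  proof (rule sum.cong[OF refl], rule fps_mult_nth_cong)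
    fix k j assume "k \<in> {..<K}" "j \<le> i"
    then show "(fps_deriv ^^ k) (\<Sum>l<N. b l * (fps_deriv ^^ l) f) $ j = (fps_deriv ^^ k) (dact Q f) $ j"
      unfolding b_def using L[unfolded b_def]
      by (intro fps_deriv_funpow_nth_cong dact_nth[symmetric]) (auto simp: N_def)
  qed simp
  also have "\<dots> = dact P (dact Q f) $ i"
    unfolding a_def fps_sum_nth[symmetric]
    by (rule dact_nth[symmetric, OF M[unfolded a_def]]) (simp add: K_def)
  finally show "dact (P * Q) f $ i = dact P (dact Q f) $ i" .
qed

lemma fps_deriv_funpow_X_power_eq_0:
  "n < k \<Longrightarrow> (fps_deriv ^^ k) (fps_X ^ n) = (0 :: 'a::comm_ring_1 fps)"
  by (rule fps_ext) (simp add: fps_deriv_funpow_nth_eq_0 fps_X_power_nth)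

lemma fps_deriv_funpow_X_power_neq_0:
  "(fps_deriv ^^ n) (fps_X ^ n) \<noteq> (0 :: 'a::field_char_0 fps)"
proof -
  have "(fps_deriv ^^ n) (fps_X ^ n) $ 0 = (fact n :: 'a)"
    by (simp add: fps_0th_higher_deriv)
  then show ?thesis by (metis fact_nonzero fps_zero_nth)
qed

lemma dact_inject:
  fixes P Q :: "'a::field_char_0 dsym"
  assumes "\<And>f. dact P f = dact Q f"
  shows "P = Q"
proof -
  have fin: "dact R (fps_X ^ n) = (\<Sum>k\<le>n. dcoeff R k * (fps_deriv ^^ k) (fps_X ^ n))"
    for R :: "'a dsym" and n
  proof -
    have "(\<lambda>k. dcoeff R k * (fps_deriv ^^ k) (fps_X ^ n)) sums
      (\<Sum>k\<le>n. dcoeff R k * (fps_deriv ^^ k) (fps_X ^ n))"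
      by (rule sums_finite) (auto simp: fps_deriv_funpow_X_power_eq_0)
    then show ?thesis unfolding dact_def by (rule sums_unique[symmetric])
  qed
  have "dcoeff P n = dcoeff Q n" for n
  proof (induction n rule: less_induct)
    case (less n)
    have "(\<Sum>k\<le>n. dcoeff P k * (fps_deriv ^^ k) (fps_X ^ n)) =
        (\<Sum>k\<le>n. dcoeff Q k * (fps_deriv ^^ k) (fps_X ^ n))"
      using assms fin by metis
    then have "dcoeff P n * (fps_deriv ^^ n) (fps_X ^ n) = dcoeff Q n * (fps_deriv ^^ n) (fps_X ^ n)"
      using less by (simp add: lessThan_Suc_atMost[symmetric])
    moreover have "(fps_deriv ^^ n) (fps_X ^ n) \<noteq> (0 :: 'a fps)"
      by (rule fps_deriv_funpow_X_power_neq_0)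
    ultimately show ?case by simp
  qed
  then show ?thesis by (simp add: dcoeff_inject[symmetric] fun_eq_iff)
qed

lemma dact_add: "dact (P + Q) f = dact P f + dact Q f"
proof (rule fps_ext)
  fix i
  obtain M L where M: "\<forall>k i. dcoeff P k $ i \<noteq> 0 \<longrightarrow> k \<le> i + M" and L: "\<forall>k i. dcoeff Q k $ i \<noteq> 0 \<longrightarrow> k \<le> i + L"
    using dcoeff_bound by metis
  have PQ: "dcoeff (P + Q) k = dcoeff P k + dcoeff Q k" for k by transfer simp
  have "\<forall>k i. dcoeff P k $ i \<noteq> 0 \<longrightarrow> k \<le> i + (M + L)" "\<forall>k i. dcoeff Q k $ i \<noteq> 0 \<longrightarrow> k \<le> i + (M + L)"
    using M L by (metis add.assoc trans_le_add1, metis add.assoc add.commute trans_le_add1)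
  moreover from this have "\<forall>k i. dcoeff (P + Q) k $ i \<noteq> 0 \<longrightarrow> k \<le> i + (M + L)"
    unfolding PQ by (metis add.right_neutral fps_add_nth)
  ultimately show "dact (P + Q) f $ i = (dact P f + dact Q f) $ i"
    by (simp add: dact_nth[where K = "Suc (i + (M + L))"] PQ distrib_right sum.distrib)
qed

lemma dact_add_right: "dact P (f + g) = dact P f + dact P g"
proof (rule fps_ext)
  fix i
  obtain M where M: "\<forall>k i. dcoeff P k $ i \<noteq> 0 \<longrightarrow> k \<le> i + M" using dcoeff_bound by metis
  then show "dact P (f + g) $ i = (dact P f + dact P g) $ i"
    by (simp add: dact_nth[where K = "Suc (i + M)"] fps_deriv_funpow_add distrib_left sum.distrib)
qed

lemma dact_1: "dact 1 f = f"
proof -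
  have "(\<lambda>k. dcoeff 1 k * (fps_deriv ^^ k) f) sums (\<Sum>k\<in>{0}. dcoeff 1 k * (fps_deriv ^^ k) f)"
    by (rule sums_finite) (auto simp: one_dsym.rep_eq)
  then show ?thesis unfolding dact_def by (simp add: sums_iff one_dsym.rep_eq)
qed

instance dsym :: (field_char_0) ring_1
proof
  fix P Q R :: "'a dsym"
  show "P * Q * R = P * (Q * R)" by (rule dact_inject) (simp add: dact_mult)
  show "1 * P = P" "P * 1 = P" by (rule dact_inject, simp add: dact_mult dact_1)+
  show "(P + Q) * R = P * R + Q * R" by (rule dact_inject) (simp add: dact_mult dact_add)
  show "P * (Q + R) = P * Q + P * R"
    by (rule dact_inject) (simp add: dact_mult dact_add dact_add_right)
  show "(0 :: 'a dsym) \<noteq> 1"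
    by (metis one_dsym.rep_eq zero_dsym.rep_eq zero_neq_one)
qed


section \<open>Differential operators, orders and homogeneous components\<close>

lift_definition dfun :: "'a::comm_ring_1 fps \<Rightarrow> 'a dsym" is "\<lambda>f k. if k = 0 then f else 0"
  by (rule exI[of _ 0]) simp

lift_definition dpartial :: "'a::comm_ring_1 dsym" is "\<lambda>k. if k = 1 then 1 else 0"
  by (rule exI[of _ 1]) simp

definition D1 :: "'a::comm_ring_1 dsym set" where
  "D1 = {P. finite {k. dcoeff P k \<noteq> 0}}"

text \<open>The degree in $\partial$, for elements of \<open>D1\<close>; as for polynomials, the zero operator gets 0
  (which is neutral in the greatest common divisors below).\<close>

definition dord :: "'a::comm_ring_1 dsym \<Rightarrow> nat" where
  "dord P = (if P = 0 then 0 else Max {k. dcoeff P k \<noteq> 0})"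

text \<open>
  The order $\sup_k (k - v(a_k))$. Since \<open>subdegree 0 = 0\<close> in the library, the zero coefficients,
  for which $k - v(a_k) = -\infty$, are left out; the zero operator has order $-\infty$.
\<close>

definition bord :: "'a::comm_ring_1 dsym \<Rightarrow> ereal" where
  "bord P = (SUP k\<in>{k. dcoeff P k \<noteq> 0}. ereal (real k - real (subdegree (dcoeff P k))))"

lift_definition hcomp :: "int \<Rightarrow> 'a::comm_ring_1 dsym \<Rightarrow> 'a dsym" is
  "\<lambda>m a k. Abs_fps (\<lambda>i. if int k - int i = m then a k $ i else 0)"
  unfolding dsym_mem_iff by (auto split: if_splits)

text \<open>For nonzero operators the order is an integer, so that the floor is only a conversion.\<close>

definition symb :: "'a::comm_ring_1 dsym \<Rightarrow> 'a dsym" where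
  "symb P = hcomp \<lfloor>real_of_ereal (bord P)\<rfloor> P"

text \<open>
  The adjoint: the image $\sum_k (-\partial)^k a_k$ of $P = \sum_k a_k \partial^k$ under the
  anti-automorphism of \<open>D1\<close> with $x \mapsto x$ and $\partial \mapsto -\partial$. Meaningful only on \<open>D1\<close>.
\<close>

definition adj :: "'a::field_char_0 dsym \<Rightarrow> 'a dsym" where
  "adj P = (\<Sum>k | dcoeff P k \<noteq> 0. (- dpartial) ^ k * dfun (dcoeff P k))"


section \<open>Normalized pairs and Schur operators\<close>

definition normalized :: "'a::field_char_0 dsym \<Rightarrow> bool" where
  "normalized P \<longleftrightarrow> P \<in> D1 \<and> dcoeff P (dord P) = 1 \<and> (dord P > 0 \<longrightarrow> dcoeff P (dord P - 1) = 0)"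

definition string_solution :: "'a::field_char_0 dsym \<Rightarrow> 'a dsym \<Rightarrow> bool" where
  "string_solution P Q \<longleftrightarrow> P \<in> D1 \<and> Q \<in> D1 \<and> Q * P - P * Q = 1 \<and> normalized P"

definition commuting_pair :: "'a::field_char_0 dsym \<Rightarrow> 'a dsym \<Rightarrow> bool" where
  "commuting_pair P Q \<longleftrightarrow> P \<in> D1 \<and> Q \<in> D1 \<and> Q * P - P * Q = 0 \<and> normalized P"

definition is_dinv :: "'a::field_char_0 dsym \<Rightarrow> 'a dsym \<Rightarrow> bool" where
  "is_dinv S T \<longleftrightarrow> S * T = 1 \<and> T * S = 1"

definition dinv :: "'a::field_char_0 dsym \<Rightarrow> 'a dsym" where
  "dinv S = (THE T. is_dinv S T)"

definition monic_schur :: "'a::field_char_0 dsym \<Rightarrow> 'a dsym \<Rightarrow> bool" where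
  "monic_schur P S \<longleftrightarrow> P \<in> D1 \<and> symb P = dpartial ^ dord P \<and>
     (\<exists>T. is_dinv S T) \<and> bord S = 0 \<and> hcomp 0 S = 1 \<and> dinv S * P * S = dpartial ^ dord P"

inductive_set kalg :: "'a::field_char_0 dsym \<Rightarrow> 'a dsym \<Rightarrow> 'a dsym set" for P Q where
  const: "dfun (fps_const c) \<in> kalg P Q"
| left: "P \<in> kalg P Q"
| right: "Q \<in> kalg P Q"
| add: "L \<in> kalg P Q \<Longrightarrow> M \<in> kalg P Q \<Longrightarrow> L + M \<in> kalg P Q"
| mult: "L \<in> kalg P Q \<Longrightarrow> M \<in> kalg P Q \<Longrightarrow> L * M \<in> kalg P Q"

definition krank :: "'a::field_char_0 dsym \<Rightarrow> 'a dsym \<Rightarrow> nat" where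
  "krank P Q = Gcd (dord ` kalg P Q)"


section \<open>Head-chopping sequences and the correspondence\<close>

text \<open>
  $Q_{i+1} = Q_i^{n_i} - \varepsilon_i^{n_i} P^{m_i}$, that is, $Q_i = F_i(P,Q)$ for $F_0 = Y$ and
  $F_{i+1} = F_i^{n_i} - \varepsilon_i^{n_i} X^{m_i}$.
\<close>

fun chop :: "'a::field_char_0 dsym \<Rightarrow> 'a dsym \<Rightarrow> (nat \<Rightarrow> nat) \<Rightarrow> (nat \<Rightarrow> nat) \<Rightarrow> (nat \<Rightarrow> 'a) \<Rightarrow> nat \<Rightarrow> 'a dsym"
  where
  "chop P Q ns ms eps 0 = Q"
| "chop P Q ns ms eps (Suc i) =
     chop P Q ns ms eps i ^ ns i - dfun (fps_const (eps i ^ ns i)) * P ^ ms i"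

text \<open>
  \<open>seqgcd P Qs j\<close> is the GCD of the orders of $P, Q_0, \ldots, Q_{j-1}$, i.e. $SeqGCD_{j-1}$;
  the shift makes $SeqGCD_{-1} = \mathrm{ord}(P)$ available.
\<close>

definition seqgcd :: "'a::field_char_0 dsym \<Rightarrow> (nat \<Rightarrow> 'a dsym) \<Rightarrow> nat \<Rightarrow> nat" where
  "seqgcd P Qs j = Gcd (insert (dord P) ((\<lambda>i. dord (Qs i)) ` {..<j}))"

definition good_chopping ::
  "'a::field_char_0 dsym \<Rightarrow> 'a dsym \<Rightarrow> nat \<Rightarrow> (nat \<Rightarrow> nat) \<Rightarrow> (nat \<Rightarrow> nat) \<Rightarrow> (nat \<Rightarrow> 'a) \<Rightarrow> bool" where
  "good_chopping P Q I ns ms eps \<longleftrightarrow>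
     (\<forall>i<I. bord (chop P Q ns ms eps (Suc i)) < bord (chop P Q ns ms eps i ^ ns i)) \<and>
     (\<forall>i\<le>I. ereal (real (dord (chop P Q ns ms eps i))) = bord (chop P Q ns ms eps i)) \<and>
     seqgcd P (chop P Q ns ms eps) (Suc I) = 1 \<and> seqgcd P (chop P Q ns ms eps) I > 1"

text \<open>The pairs to which the correspondence applies.\<close>

definition admissible :: "'a::field_char_0 dsym \<Rightarrow> 'a dsym \<Rightarrow> bool" where
  "admissible P Q \<longleftrightarrow> string_solution P Q \<and>
     (\<exists>m n d. 1 < m \<and> 1 < n \<and> coprime m n \<and> dord P = n * d \<and> dord Q = m * d) \<and>
     ereal (real (dord Q)) = bord Q \<and>
     (\<exists>I ns ms eps. good_chopping P Q I ns ms eps)"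

definition corr_rel ::
  "'a::field_char_0 dsym \<Rightarrow> 'a dsym \<Rightarrow> 'a dsym \<Rightarrow> 'a dsym \<Rightarrow> bool" where
  "corr_rel P Q P' Q' \<longleftrightarrow> commuting_pair P' Q' \<and> dord P' = dord P \<and> dord Q' = dord Q \<and>
     krank P' Q' = 1 \<and>
     (\<exists>S S'. monic_schur P S \<and> monic_schur P' S' \<and>
        dinv S' * Q' * S' = dinv S * Q * S - hcomp (- int (dord P)) (dinv S * Q * S))"

text \<open>
  $(P', Q')$ is \<^emph>\<open>the\<close> pair corresponding to $(P, Q)$, i.e. the unique pair in relation
  \<open>corr_rel\<close> with it.
\<close>

definition corresponding_pair ::
  "'a::field_char_0 dsym \<Rightarrow> 'a dsym \<Rightarrow> 'a dsym \<Rightarrow> 'a dsym \<Rightarrow> bool" where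
  "corresponding_pair P Q P' Q' \<longleftrightarrow>
     (\<forall>A B. corr_rel P Q A B \<longleftrightarrow> A = P' \<and> B = Q')"

text \<open>
  Since $\ast(\partial^p) = (-1)^p \partial^p$, the pair $(\ast P, -\ast Q)$ has a monic first member
  only for even $p$. For odd $p$ the normalized solution of the string equation is obtained by
  changing both signs: $(-\ast P, \ast Q)$; likewise for the commuting pair.
\<close>

end

theory Submission
  imports Defs
begin

text \<open>
  The adjoint does not extend to the Schur operators, so the Schur operators of the adjoint pair are
  obtained by duality. For a differential operator $L$ let $\beta_L(u,v)$ be the bilinear concomitant
  of $L$, evaluated at $x = 0$; it satisfies $\beta_{LM}(u,v) = \beta_L(Mu,v) + \beta_M(u,{*}(L)v)$.
  Given a Schur operator $S$ for $P$ there is a Schur operator $T$ for $\pm{*}(P)$ with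
  $\beta_P(Su,Tv) = \beta_{\partial^p}(u,v)$. For such a pair, $\beta_{QP} = \beta_{PQ}$ (as $[Q,P]$ is a
  constant) shows that the coefficients of $T^{-1}{*}(Q)T$ on the basis $x^n/n!$ with target index
  below $p$ are, up to sign, a transpose of those of $S^{-1}QS$. The correction by the component of
  degree $-p$ does not touch these coefficients, and they determine every operator commuting with
  $\partial^p$; so the defining relation of the correspondence passes from $(P,Q), (P',Q')$ to the
  adjoint pairs. Uniqueness follows because the adjoint is an involution on $D_1$.
\<close>

section \<open>Coefficients of operators\<close>

text \<open>In the formal adjoint of an infinite series, the coefficient of
  \<open>dpartial ^ n\<close> collects, for every k, a multiple of the (k - n)-th derivative of a_k.
  A bound on k - v(a_k) gives these derivatives no growing valuation, so the sum need not converge.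
  Formally the Schur operator of the adjoint would be the inverse of the adjoint of
  \<open>S\<close>. The concomitant replaces that expression: for an operator of degree p it depends
  only on the jets below p of its two arguments, and intertwining with \<open>dpartial ^ p\<close>
  reaches the remaining jets in steps of p. A multiplication operator has zero concomitant, which is
  why the string equation and commutativity can be treated alike.\<close>

lemma dcoeff_add: "dcoeff (P + Q) k = dcoeff P k + dcoeff Q k"
  by transfer simp

lemma dcoeff_uminus: "dcoeff (- P) k = - dcoeff P k"
  by transfer simp

lemma dcoeff_0: "dcoeff 0 k = 0"
  by transfer simp

lemma dcoeff_diff: "dcoeff (P - Q) k = dcoeff P k - dcoeff Q k"
  unfolding minus_dsym_def dcoeff_add dcoeff_uminus by simp

lemma dcoeff_1: "dcoeff 1 k = (if k = 0 then 1 else 0)"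
  by transfer simp

lemma dcoeff_dfun: "dcoeff (dfun f) k = (if k = 0 then f else 0)"
  by transfer simp

lemma dcoeff_dpartial: "dcoeff dpartial k = (if k = 1 then 1 else 0)"
  by transfer simp

lemmas dcoeff_simps = dcoeff_add dcoeff_uminus dcoeff_0 dcoeff_diff dcoeff_1 dcoeff_dfun dcoeff_dpartial

lemma dcoeff_sum: "dcoeff (\<Sum>x\<in>A. P x) k = (\<Sum>x\<in>A. dcoeff (P x) k)"
  by (induction A rule: infinite_finite_induct) (simp_all add: dcoeff_simps)

lemma dsym_coeff_eqI: "(\<And>k. dcoeff P k = dcoeff Q k) \<Longrightarrow> P = Q"
  by (simp add: dcoeff_inject[symmetric] fun_eq_iff)

lemma dcoeff_dfun_mult: "dcoeff (dfun f * P) n = f * dcoeff P n"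
proof (rule fps_ext)
  fix i
  let ?g = "\<lambda>k. \<Sum>t\<in>{t. t \<le> k \<and> k \<le> n + t}.
      of_nat (k choose t) * dcoeff (dfun f) k * (fps_deriv ^^ t) (dcoeff P (n + t - k))"
  have "dcoeff (dfun f * P) n $ i = (\<Sum>k<Suc i. ?g k) $ i"
    unfolding times_dsym.rep_eq
    by (rule dmult_coeff_nth[of _ 0]) (auto simp: dcoeff_dfun)
  also have "(\<Sum>k<Suc i. ?g k) = (\<Sum>k<Suc i. if k = 0 then f * dcoeff P n else 0)"
  proof (rule sum.cong[OF refl])
    fix k
    have "{t. t = (0::nat)} = {0}" by auto
    then show "?g k = (if k = 0 then f * dcoeff P n else 0)"
      by (cases "k = 0") (simp_all add: dcoeff_dfun)
  qed
  finally show "dcoeff (dfun f * P) n $ i = (f * dcoeff P n) $ i" by simp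
qed

lemma dcoeff_dpartial_mult:
  "dcoeff (dpartial * P) n = (if n = 0 then 0 else dcoeff P (n - 1)) + fps_deriv (dcoeff P n)"
proof (rule fps_ext)
  fix i
  let ?r = "(if n = 0 then 0 else dcoeff P (n - 1)) + fps_deriv (dcoeff P n)"
  let ?g = "\<lambda>k. \<Sum>t\<in>{t. t \<le> k \<and> k \<le> n + t}.
      of_nat (k choose t) * dcoeff dpartial k * (fps_deriv ^^ t) (dcoeff P (n + t - k))"
  have "dcoeff (dpartial * P) n $ i = (\<Sum>k<i+2. ?g k) $ i"
    unfolding times_dsym.rep_eq
    by (rule dmult_coeff_nth[of _ 1]) (auto simp: dcoeff_dpartial)
  also have "(\<Sum>k<i+2. ?g k) = (\<Sum>k<i+2. if k = 1 then ?r else 0)"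
  proof (rule sum.cong[OF refl])
    fix k
    have "{t. t \<le> (1::nat) \<and> 1 \<le> n + t} = (if n = 0 then {1} else {0, 1})" by auto
    then show "?g k = (if k = 1 then ?r else 0)"
      by (cases "k = 1") (simp_all add: dcoeff_dpartial)
  qed
  finally show "dcoeff (dpartial * P) n $ i = ?r $ i" by simp
qed

lemma dcoeff_mult_dpartial:
  "dcoeff (P * dpartial) n = (if n = 0 then 0 else dcoeff P (n - 1))"
proof (rule fps_ext)
  fix i
  obtain M where M: "\<forall>k i. dcoeff P k $ i \<noteq> 0 \<longrightarrow> k \<le> i + M" using dcoeff_bound by metis
  let ?g = "\<lambda>k. \<Sum>t\<in>{t. t \<le> k \<and> k \<le> n + t}.
      of_nat (k choose t) * dcoeff P k * (fps_deriv ^^ t) (dcoeff dpartial (n + t - k))"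
  \<comment> \<open>The cutoff exceeds \<open>i + M\<close>, as the truncation of the product
    requires, and also \<open>n - 1\<close>, the only index with a nonzero term.\<close>
  have "dcoeff (P * dpartial) n $ i = (\<Sum>k<i+M+n+1. ?g k) $ i"
    unfolding times_dsym.rep_eq
    by (rule dmult_coeff_nth[OF M]) auto
  also have "(\<Sum>k<i+M+n+1. ?g k) = (\<Sum>k<i+M+n+1. if Suc k = n then dcoeff P (n - 1) else 0)"
  proof (rule sum.cong[OF refl])
    fix k
    have "?g k = (\<Sum>t\<in>{t. t \<le> k \<and> k \<le> n + t}. if t = 0 \<and> Suc k = n then dcoeff P k else 0)"
      by (rule sum.cong) (auto simp: dcoeff_dpartial fps_deriv_funpow_0 fps_deriv_funpow_1)
    also have "\<dots> = (if Suc k = n then dcoeff P (n - 1) else 0)"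
      by (cases "Suc k = n") auto
    finally show "?g k = (if Suc k = n then dcoeff P (n - 1) else 0)" .
  qed
  also have "\<dots> = (if n = 0 then 0 else dcoeff P (n - 1))"
    by (cases n) simp_all
  finally show "dcoeff (P * dpartial) n $ i = (if n = 0 then 0 else dcoeff P (n - 1)) $ i" .
qed

lemma dfun_add: "dfun (f + g) = dfun f + dfun g"
  by (rule dsym_coeff_eqI) (simp add: dcoeff_simps)

lemma dfun_uminus: "dfun (- f) = - dfun f"
  by (rule dsym_coeff_eqI) (simp add: dcoeff_simps)

lemma dfun_1: "dfun 1 = 1"
  by (rule dsym_coeff_eqI) (simp add: dcoeff_simps)

lemma dfun_0: "dfun 0 = 0"
  by (rule dsym_coeff_eqI) (simp add: dcoeff_simps)

lemma dfun_mult: "dfun (f * g) = dfun f * dfun g"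
  by (rule dsym_coeff_eqI) (simp add: dcoeff_dfun_mult dcoeff_simps)

lemma dpartial_dfun: "dpartial * dfun f = dfun f * dpartial + dfun (fps_deriv f)"
  by (rule dsym_coeff_eqI) (simp add: dcoeff_dpartial_mult dcoeff_dfun_mult dcoeff_simps)

lemma dcoeff_mult_dpartial_power:
  "dcoeff (P * dpartial ^ p) n = (if n < p then 0 else dcoeff P (n - p))"
  for P :: "'a::field_char_0 dsym"
proof (induction p arbitrary: n)
  case (Suc p)
  have "P * dpartial ^ Suc p = P * dpartial ^ p * dpartial"
    by (simp only: power_Suc2 mult.assoc)
  then show ?case by (auto simp: dcoeff_mult_dpartial Suc)
qed simp

lemma dcoeff_dpartial_power:
  "dcoeff (dpartial ^ p :: 'a::field_char_0 dsym) n = (if n = p then 1 else 0)"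
  using dcoeff_mult_dpartial_power[of 1 p n] by (auto simp: dcoeff_simps)

lemma dact_dfun: "dact (dfun f) g = f * g"
proof -
  have "(\<lambda>k. dcoeff (dfun f) k * (fps_deriv ^^ k) g) sums (\<Sum>k\<in>{0}. dcoeff (dfun f) k * (fps_deriv ^^ k) g)"
    by (rule sums_finite) (auto simp: dcoeff_simps)
  then show ?thesis unfolding dact_def by (simp add: sums_iff dcoeff_simps)
qed

lemma dsym_scalar_commute:
  "dfun (fps_const c) * P = P * dfun (fps_const c)" for P :: "'a::field_char_0 dsym"
proof (rule dact_inject)
  fix f
  have D: "(fps_deriv ^^ k) (fps_const c * f) = fps_const c * (fps_deriv ^^ k) f" for k
    by (induction k) simp_all
  show "dact (dfun (fps_const c) * P) f = dact (P * dfun (fps_const c)) f"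
  proof (rule fps_ext)
    fix i
    obtain M where M: "\<forall>k i. dcoeff P k $ i \<noteq> 0 \<longrightarrow> k \<le> i + M" using dcoeff_bound by metis
    show "dact (dfun (fps_const c) * P) f $ i = dact (P * dfun (fps_const c)) f $ i"
      by (simp add: dact_mult dact_dfun dact_nth[OF M lessI] D sum_distrib_left fps_sum_nth mult.left_commute
        del: sum.lessThan_Suc)
  qed
qed

section \<open>Operators as filtered endomorphisms of the power series\<close>

lemma dact_dpartial: "dact dpartial g = fps_deriv g"
proof -
  have "(\<lambda>k. dcoeff dpartial k * (fps_deriv ^^ k) g) sums (\<Sum>k\<in>{1}. dcoeff dpartial k * (fps_deriv ^^ k) g)"
    by (rule sums_finite) (auto simp: dcoeff_simps)
  then show ?thesis unfolding dact_def by (simp add: sums_iff dcoeff_simps)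
qed

lemma dact_dpartial_power: "dact (dpartial ^ p) g = (fps_deriv ^^ p) g" for g :: "'a::field_char_0 fps"
  by (induction p) (simp_all add: dact_1 dact_mult dact_dpartial)

lemma dact_0: "dact 0 f = 0"
  using dact_add[of 0 0 f] by simp

lemma dact_uminus: "dact (- P) f = - dact P f"
  using dact_add[of P "- P" f] by (simp add: dact_0 add_eq_0_iff)

lemma dact_diff: "dact (P - Q) f = dact P f - dact Q f"
  using dact_add[of "P - Q" Q f] by simp

lemma dact_0_right: "dact P 0 = 0"
  using dact_add_right[of P 0 0] by simp

lemma dact_diff_right: "dact P (f - g) = dact P f - dact P g"
  using dact_add_right[of P "f - g" g] by simp

lemma dact_scale: "dact P (fps_const c * f) = fps_const c * dact P f" for P :: "'a::field_char_0 dsym"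
  using dsym_scalar_commute[of c P] by (metis dact_dfun dact_mult)

text \<open>The divided powers x^n/n!: differentiation shifts their index down without
  factors.\<close>

definition expb :: "nat \<Rightarrow> 'a::field_char_0 fps" where
  "expb n = Abs_fps (\<lambda>i. if i = n then inverse (fact n) else 0)"

lemma expb_nth: "expb n $ i = (if i = n then inverse (fact n) else 0)"
  by (simp add: expb_def)

lemma expb_0: "expb 0 = 1"
  by (rule fps_ext) (simp add: expb_nth)

lemma fps_deriv_expb: "fps_deriv (expb n) = (if n = 0 then 0 else expb (n - 1))"
  by (rule fps_ext) (auto simp: expb_nth field_simps simp del: of_nat_Suc)

lemma fps_deriv_funpow_expb: "(fps_deriv ^^ k) (expb n) = (if k \<le> n then expb (n - k) else 0)"
  by (induction k) (auto simp: fps_deriv_expb expb_0 not_less_eq_eq le_antisym)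

lemma dact_expb: "dact P (expb n) = (\<Sum>k\<le>n. dcoeff P k * expb (n - k))"
proof -
  have "(\<lambda>k. dcoeff P k * (fps_deriv ^^ k) (expb n)) sums (\<Sum>k\<le>n. dcoeff P k * (fps_deriv ^^ k) (expb n))"
    by (rule sums_finite) (auto simp: fps_deriv_funpow_expb)
  then have "dact P (expb n) = (\<Sum>k\<le>n. dcoeff P k * (fps_deriv ^^ k) (expb n))"
    unfolding dact_def by (rule sums_unique[symmetric])
  also have "\<dots> = (\<Sum>k\<le>n. dcoeff P k * expb (n - k))"
    by (rule sum.cong) (auto simp: fps_deriv_funpow_expb)
  finally show ?thesis .
qed

section \<open>Valuation bounds and the filtration by order\<close>

definition val_ge :: "int \<Rightarrow> 'a::comm_ring_1 fps \<Rightarrow> bool" where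
  "val_ge n f \<longleftrightarrow> (\<forall>i. int i < n \<longrightarrow> f $ i = 0)"

lemma val_ge_nonpos: "n \<le> 0 \<Longrightarrow> val_ge n f"
  by (simp add: val_ge_def)

lemma val_ge_mono: "val_ge n f \<Longrightarrow> m \<le> n \<Longrightarrow> val_ge m f"
  by (auto simp: val_ge_def)

lemma val_ge_add: "val_ge n f \<Longrightarrow> val_ge n g \<Longrightarrow> val_ge n (f + g)"
  by (auto simp: val_ge_def)

lemma val_ge_diff: "val_ge n f \<Longrightarrow> val_ge n g \<Longrightarrow> val_ge n (f - g)"
  by (auto simp: val_ge_def)

lemma val_ge_sum: "(\<And>x. x \<in> A \<Longrightarrow> val_ge n (f x)) \<Longrightarrow> val_ge n (\<Sum>x\<in>A. f x)"
  by (auto simp: val_ge_def fps_sum_nth intro!: sum.neutral)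

lemma val_ge_mult:
  assumes "\<And>i. int i < m \<Longrightarrow> f $ i = 0" and "val_ge n g"
  shows "val_ge (m + n) (f * g)"
  unfolding val_ge_def
proof (intro allI impI)
  fix i assume "int i < m + n"
  then have "f $ j * g $ (i - j) = 0" if "j \<le> i" for j
    using assms that by (cases "int j < m") (auto simp: val_ge_def of_nat_diff)
  then show "(f * g) $ i = 0" by (simp add: fps_mult_nth)
qed

lemma val_ge_mult_left: "val_ge n g \<Longrightarrow> val_ge n (f * g)"
  using val_ge_mult[of 0 f n g] by simp

lemma val_ge_expb: "val_ge (int n) (expb n)"
  by (simp add: val_ge_def expb_nth)

lemma val_ge_deriv_funpow: "val_ge n f \<Longrightarrow> val_ge (n - int k) ((fps_deriv ^^ k) f)"
  by (auto simp: val_ge_def intro!: fps_deriv_funpow_nth_eq_0)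

text \<open>An integer upper bound for \<open>bord\<close>, free of extended reals;
  \<open>bord_leI\<close> and \<open>bord_leD\<close> translate. The zero operator satisfies every
  bound.\<close>

definition ordle :: "'a::comm_ring_1 dsym \<Rightarrow> int \<Rightarrow> bool" where
  "ordle P d \<longleftrightarrow> (\<forall>k i. dcoeff P k $ i \<noteq> 0 \<longrightarrow> int k \<le> int i + d)"

lemma ordle_val_ge_coeff: "ordle P d \<longleftrightarrow> (\<forall>k. val_ge (int k - d) (dcoeff P k))"
  unfolding ordle_def val_ge_def less_diff_eq not_less[symmetric] by blast

lemma ordle_dact:
  assumes P: "ordle P d" and f: "val_ge n f"
  shows "val_ge (n - d) (dact P f)"
  unfolding val_ge_def
proof (intro allI impI)
  fix i assume i: "int i < n - d"
  obtain M where M: "\<forall>k i. dcoeff P k $ i \<noteq> 0 \<longrightarrow> k \<le> i + M" using dcoeff_bound by metis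
  have "val_ge (n - d) (dcoeff P k * (fps_deriv ^^ k) f)" for k
    using val_ge_mult[of "int k - d" "dcoeff P k" "n - int k"] P val_ge_deriv_funpow[OF f, of k]
    unfolding ordle_val_ge_coeff by (auto simp: val_ge_def)
  then show "dact P f $ i = 0"
    using i unfolding dact_nth[OF M lessI] fps_sum_nth by (intro sum.neutral) (auto simp: val_ge_def)
qed

text \<open>The summand at k = n is \<open>a n\<close> itself, since \<open>expb 0 = 1\<close>. The
  earlier summands satisfy the bound by induction, with \<open>expb (n - k)\<close> supplying the
  missing valuation.\<close>

lemma ordle_expbI:
  fixes a :: "nat \<Rightarrow> 'a::field_char_0 fps"
  assumes "\<And>n. val_ge (int n - d) (\<Sum>k\<le>n. a k * expb (n - k))"
  shows "val_ge (int n - d) (a n)"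
proof (induction n rule: less_induct)
  case (less n)
  have "(\<Sum>k\<le>n. a k * expb (n - k)) = (\<Sum>k<n. a k * expb (n - k)) + a n"
    by (simp add: lessThan_Suc_atMost[symmetric] expb_0)
  then have eq: "a n = (\<Sum>k\<le>n. a k * expb (n - k)) - (\<Sum>k<n. a k * expb (n - k))" by simp
  show ?case
    unfolding eq
  proof (rule val_ge_diff[OF assms], rule val_ge_sum)
    fix k assume "k \<in> {..<n}"
    then have k: "k < n" by simp
    then have "val_ge ((int k - d) + int (n - k)) (a k * expb (n - k))"
      using less[OF k] by (intro val_ge_mult val_ge_expb) (auto simp: val_ge_def)
    then show "val_ge (int n - d) (a k * expb (n - k))" using k by (simp add: of_nat_diff)
  qed
qed

lemma ordle_iff_expb:
  "ordle P d \<longleftrightarrow> (\<forall>n. val_ge (int n - d) (dact P (expb n)))" for P :: "'a::field_char_0 dsym"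
proof
  assume "ordle P d"
  then show "\<forall>n. val_ge (int n - d) (dact P (expb n))" by (blast intro: ordle_dact val_ge_expb)
next
  assume "\<forall>n. val_ge (int n - d) (dact P (expb n))"
  then show "ordle P d"
    unfolding ordle_val_ge_coeff dact_expb using ordle_expbI[of d "dcoeff P"] by blast
qed

lemma ordle_mult: "ordle P d \<Longrightarrow> ordle Q e \<Longrightarrow> ordle (P * Q) (d + e)" for P :: "'a::field_char_0 dsym"
  unfolding ordle_iff_expb[of "P * Q"] dact_mult
  by (metis diff_diff_eq add.commute ordle_dact val_ge_expb)

lemma ordle_add: "ordle P d \<Longrightarrow> ordle Q d \<Longrightarrow> ordle (P + Q) d"
  by (auto simp: ordle_val_ge_coeff dcoeff_simps intro: val_ge_add)

lemma ordle_uminus: "ordle (- P) d \<longleftrightarrow> ordle P d"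
  by (simp add: ordle_def dcoeff_simps)

lemma ordle_diff: "ordle P d \<Longrightarrow> ordle Q d \<Longrightarrow> ordle (P - Q) d"
  by (auto simp: ordle_val_ge_coeff dcoeff_simps intro: val_ge_diff)

lemma ordle_sum: "(\<And>x. x \<in> A \<Longrightarrow> ordle (P x) d) \<Longrightarrow> ordle (\<Sum>x\<in>A. P x) d"
  by (auto simp: ordle_val_ge_coeff dcoeff_sum intro: val_ge_sum)

lemma ordle_mono: "ordle P d \<Longrightarrow> d \<le> e \<Longrightarrow> ordle P e"
  unfolding ordle_def by fastforce

lemma ordle_1: "ordle 1 0"
  by (simp add: ordle_def dcoeff_simps)

lemma ordle_all_eq_0:
  assumes "\<And>d. ordle P d" shows "P = 0"
proof (rule dsym_eqI)
  fix k i show "dcoeff P k $ i = dcoeff 0 k $ i"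
    using assms[of "int k - int i - 1"] unfolding ordle_def by (force simp: dcoeff_simps)
qed

lemma dsym_eq_expb:
  fixes P Q :: "'a::field_char_0 dsym"
  assumes "\<And>n. dact P (expb n) = dact Q (expb n)"
  shows "P = Q"
proof -
  have "P - Q = 0"
    by (rule ordle_all_eq_0) (simp add: ordle_iff_expb dact_diff assms val_ge_def)
  then show ?thesis by simp
qed

text \<open>The image of \<open>expb n\<close> involves the coefficients up to \<open>n\<close>, the
  last one with factor 1, so prescribed images determine the coefficients recursively. Inverses and
  dual Schur operators are constructed this way.\<close>

lemma dsym_of_images:
  fixes v :: "nat \<Rightarrow> 'a::field_char_0 fps"
  assumes v: "\<And>n. val_ge (int n - d) (v n)"
  shows "\<exists>P. ordle P d \<and> (\<forall>n. dact P (expb n) = v n)"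
proof -
  define R where "R = (\<lambda>(a :: nat \<Rightarrow> 'a fps) n. v n - (\<Sum>k<n. a k * expb (n - k)))"
  define a where "a = wfrec {(i, j). i < j} R"
  have adm: "adm_wf {(i, j). i < j} R"
    unfolding adm_wf_def R_def by (auto intro!: sum.cong)
  have "a = R a"
    unfolding a_def by (rule wfrec_fixpoint) (use adm wf_less in auto)
  then have a: "a n = v n - (\<Sum>k<n. a k * expb (n - k))" for n by (metis R_def)
  have sum: "(\<Sum>k\<le>n. a k * expb (n - k)) = v n" for n
    using a[of n] by (simp add: lessThan_Suc_atMost[symmetric] expb_0)
  have bnd: "val_ge (int n - d) (a n)" for n
    by (rule ordle_expbI) (simp add: sum v)
  have "\<exists>M. \<forall>k i. a k $ i \<noteq> 0 \<longrightarrow> k \<le> i + M"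
  proof (intro exI allI impI)
    fix k i assume "a k $ i \<noteq> 0"
    then have "int k - d \<le> int i" using bnd[of k] unfolding val_ge_def by (meson not_le)
    then show "k \<le> i + nat d" by linarith
  qed
  then have coeff: "dcoeff (Abs_dsym a) = a"
    by (intro Abs_dsym_inverse) (simp add: dsym_mem_iff)
  show ?thesis
    by (intro exI[of _ "Abs_dsym a"] conjI allI) (simp_all add: ordle_val_ge_coeff dact_expb coeff bnd sum)
qed

text \<open>The n-th derivative at the origin, that is, the coordinate functional dual to
  \<open>expb n\<close>.\<close>

definition jet :: "nat \<Rightarrow> 'a::field_char_0 fps \<Rightarrow> 'a" where
  "jet n f = fact n * f $ n"

lemma jet_deriv_funpow: "(fps_deriv ^^ n) f $ 0 = jet n f"
  by (simp add: jet_def fps_0th_higher_deriv)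

lemma jet_deriv: "jet n ((fps_deriv ^^ k) f) = jet (n + k) f"
  by (simp only: jet_deriv_funpow[symmetric] funpow_add o_apply)

lemma jet_expb: "jet n (expb m) = (if n = m then 1 else 0)"
  by (simp add: jet_def expb_nth)

lemma jet_simps: "jet n (f + g) = jet n f + jet n g" "jet n (- f) = - jet n f"
  "jet n (f - g) = jet n f - jet n g" "jet n (fps_const c * f) = c * jet n f" "jet n 0 = 0"
  by (simp_all add: jet_def algebra_simps)

lemma jet_val_ge: "val_ge m f \<Longrightarrow> int n < m \<Longrightarrow> jet n f = 0"
  by (simp add: jet_def val_ge_def)

lemma fps_eq_jetI: "(\<And>n. jet n f = jet n g) \<Longrightarrow> f = g"
  by (rule fps_ext) (simp add: jet_def)

lemma fps_truncate:
  "val_ge (int N) (f - (\<Sum>i<N. fps_const (jet i f) * expb i))"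
  by (auto simp: val_ge_def fps_sum_nth expb_nth jet_def if_distrib[of "(*) _"] cong: if_cong)

section \<open>Differential operators and the adjoint\<close>

definition dmon :: "'a::field_char_0 fps \<Rightarrow> nat \<Rightarrow> 'a dsym" where
  "dmon f k = dfun f * dpartial ^ k"

lemma dcoeff_dmon: "dcoeff (dmon f k) n = (if n = k then f else 0)"
  by (simp add: dmon_def dcoeff_dfun_mult dcoeff_dpartial_power)

lemma D1_iff: "P \<in> D1 \<longleftrightarrow> (\<exists>N. \<forall>k\<ge>N. dcoeff P k = 0)"
proof
  assume "P \<in> D1"
  then obtain N where "\<forall>k\<in>{k. dcoeff P k \<noteq> 0}. k < N"
    unfolding D1_def using finite_nat_set_iff_bounded by blast
  then show "\<exists>N. \<forall>k\<ge>N. dcoeff P k = 0" by (metis mem_Collect_eq not_le)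
next
  assume "\<exists>N. \<forall>k\<ge>N. dcoeff P k = 0"
  then obtain N where "\<forall>k\<ge>N. dcoeff P k = 0" ..
  then have "{k. dcoeff P k \<noteq> 0} \<subseteq> {..<N}" by (metis (mono_tags) lessThan_iff mem_Collect_eq not_le subsetI)
  then show "P \<in> D1" unfolding D1_def using finite_subset by blast
qed

lemma D1_eq_sum:
  assumes "\<forall>k\<ge>N. dcoeff P k = 0"
  shows "P = (\<Sum>k<N. dmon (dcoeff P k) k)"
  by (rule dsym_coeff_eqI) (use assms in \<open>auto simp: dcoeff_sum dcoeff_dmon not_less\<close>)

lemma D1_dmon: "dmon f k \<in> D1"
  unfolding D1_iff by (intro exI[of _ "Suc k"]) (auto simp: dcoeff_dmon)

lemma D1_dfun: "dfun f \<in> D1"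
  unfolding D1_iff by (intro exI[of _ 1]) (simp add: dcoeff_simps)

lemma D1_0: "0 \<in> D1"
  unfolding D1_iff by (simp add: dcoeff_simps)

lemma D1_1: "1 \<in> D1"
  unfolding D1_iff by (intro exI[of _ 1]) (simp add: dcoeff_simps)

lemma D1_dpartial: "dpartial \<in> D1"
  unfolding D1_iff by (intro exI[of _ 2]) (simp add: dcoeff_simps)

lemma D1_add: assumes "P \<in> D1" "Q \<in> D1" shows "P + Q \<in> D1"
proof -
  obtain N M where "\<forall>k\<ge>N. dcoeff P k = 0" "\<forall>k\<ge>M. dcoeff Q k = 0"
    using assms D1_iff by metis
  then show ?thesis unfolding D1_iff
    by (intro exI[of _ "max N M"]) (simp add: dcoeff_simps)
qed

lemma D1_uminus: "P \<in> D1 \<Longrightarrow> - P \<in> D1"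
  unfolding D1_iff by (simp add: dcoeff_simps)

lemma D1_diff: "P \<in> D1 \<Longrightarrow> Q \<in> D1 \<Longrightarrow> P - Q \<in> D1"
  by (metis D1_add D1_uminus add_uminus_conv_diff)

lemma D1_sum: "(\<And>x. x \<in> A \<Longrightarrow> P x \<in> D1) \<Longrightarrow> (\<Sum>x\<in>A. P x) \<in> D1"
  by (induction A rule: infinite_finite_induct) (simp_all add: D1_0 D1_add)

lemma D1_add_induct [consumes 1, case_names dmon add]:
  assumes "P \<in> D1"
    and "\<And>f k. R (dmon f k)" "\<And>P Q. P \<in> D1 \<Longrightarrow> Q \<in> D1 \<Longrightarrow> R P \<Longrightarrow> R Q \<Longrightarrow> R (P + Q)"
  shows "R P"
proof -
  have R0: "R 0" using assms(2)[of 0 0] by (simp add: dmon_def dfun_0)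
  obtain N where "\<forall>k\<ge>N. dcoeff P k = 0" using assms(1) D1_iff by metis
  moreover have "R (\<Sum>k<N. dmon (a k) k)" for a
  proof (induction N)
    case (Suc N)
    then show ?case by (auto intro!: assms(2,3) D1_sum D1_dmon)
  qed (simp add: R0)
  ultimately show ?thesis using D1_eq_sum by metis
qed

lemma dfun_mult_dmon: "dfun f * dmon g k = dmon (f * g) k"
  by (simp add: dmon_def dfun_mult mult.assoc)

lemma dpartial_mult_dmon: "dpartial * dmon g k = dmon g (Suc k) + dmon (fps_deriv g) k"
proof -
  have "dpartial * dmon g k = (dpartial * dfun g) * dpartial ^ k" by (simp add: dmon_def mult.assoc)
  then show ?thesis by (simp add: dmon_def dpartial_dfun distrib_right mult.assoc)
qed

lemma D1_dfun_mult: "P \<in> D1 \<Longrightarrow> dfun f * P \<in> D1" for P :: "'a::field_char_0 dsym"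
  by (induction rule: D1_add_induct) (simp_all add: dfun_mult_dmon D1_dmon distrib_left D1_add)

lemma D1_dpartial_mult: "P \<in> D1 \<Longrightarrow> dpartial * P \<in> D1" for P :: "'a::field_char_0 dsym"
  by (induction rule: D1_add_induct) (simp_all add: dpartial_mult_dmon D1_dmon distrib_left D1_add)

lemma D1_mult: "P \<in> D1 \<Longrightarrow> Q \<in> D1 \<Longrightarrow> P * Q \<in> D1" for P :: "'a::field_char_0 dsym"
proof (induction rule: D1_add_induct)
  case (dmon f k)
  have "dpartial ^ k * Q \<in> D1"
    using dmon by (induction k) (simp_all add: D1_dpartial_mult mult.assoc)
  then show ?case by (simp add: dmon_def mult.assoc D1_dfun_mult)
qed (simp add: distrib_right D1_add)

lemma D1_power: "P \<in> D1 \<Longrightarrow> P ^ n \<in> D1" for P :: "'a::field_char_0 dsym"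
  by (induction n) (simp_all add: D1_1 D1_mult)

lemma D1_induct [consumes 1, case_names dfun dpartial add mult]:
  fixes P :: "'a::field_char_0 dsym"
  assumes "P \<in> D1"
    and "\<And>f. R (dfun f)" "R dpartial"
    and "\<And>P Q. P \<in> D1 \<Longrightarrow> Q \<in> D1 \<Longrightarrow> R P \<Longrightarrow> R Q \<Longrightarrow> R (P + Q)"
    and "\<And>P Q. P \<in> D1 \<Longrightarrow> Q \<in> D1 \<Longrightarrow> R P \<Longrightarrow> R Q \<Longrightarrow> R (P * Q)"
  shows "R P"
  using assms(1)
proof (induction rule: D1_add_induct)
  case (dmon f k)
  have "(dpartial ^ k :: 'a dsym) \<in> D1 \<and> R (dpartial ^ k)"
  proof (induction k)
    case 0
    show ?case using assms(2)[of 1] by (simp add: D1_1 dfun_1)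
  qed (simp add: assms(3,5) D1_dpartial D1_mult)
  then show ?case by (simp add: dmon_def assms(2,5) D1_dfun)
qed (fact assms(4))

section \<open>The adjoint as an anti-automorphism of \<open>D1\<close>\<close>

lemma adj_eq_sum:
  assumes "\<forall>k\<ge>N. dcoeff P k = 0"
  shows "adj P = (\<Sum>k<N. (- dpartial) ^ k * dfun (dcoeff P k))"
  unfolding adj_def
proof (rule sum.mono_neutral_left)
  show "{k. dcoeff P k \<noteq> 0} \<subseteq> {..<N}" using assms by (auto simp: not_less[symmetric])
qed (auto simp: dfun_0)

lemma adj_dmon: "adj (dmon f k) = (- dpartial) ^ k * dfun f"
  by (subst adj_eq_sum[of "Suc k"]) (auto simp: dcoeff_dmon if_distrib[of dfun] if_distrib[of "(*) _"] dfun_0 cong: if_cong)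

lemma adj_add: assumes "P \<in> D1" "Q \<in> D1" shows "adj (P + Q) = adj P + adj Q"
proof -
  obtain N M where "\<forall>k\<ge>N. dcoeff P k = 0" "\<forall>k\<ge>M. dcoeff Q k = 0"
    using assms D1_iff by metis
  then have *: "\<forall>k\<ge>max N M. dcoeff P k = 0" "\<forall>k\<ge>max N M. dcoeff Q k = 0" by auto
  then have "\<forall>k\<ge>max N M. dcoeff (P + Q) k = 0" by (simp add: dcoeff_simps)
  then show ?thesis
    using *[THEN adj_eq_sum] adj_eq_sum[of "max N M" "P + Q"]
    by (simp add: dcoeff_simps dfun_add distrib_left sum.distrib)
qed

lemma adj_dfun: "adj (dfun f) = dfun f"
  using adj_dmon[of f 0] by (simp add: dmon_def)

lemma adj_0: "adj 0 = 0"
  using adj_dfun[of 0] by (simp add: dfun_0)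

lemma adj_1: "adj 1 = 1"
  using adj_dfun[of 1] by (simp add: dfun_1)

lemma adj_dpartial: "adj dpartial = - dpartial"
  using adj_dmon[of 1 1] by (simp add: dmon_def dfun_1)

lemma adj_uminus: assumes "P \<in> D1" shows "adj (- P) = - adj P"
  using adj_add[OF assms D1_uminus[OF assms]] by (simp add: adj_0 eq_neg_iff_add_eq_0 add.commute)

lemma adj_diff: "P \<in> D1 \<Longrightarrow> Q \<in> D1 \<Longrightarrow> adj (P - Q) = adj P - adj Q"
  using adj_add[of P "- Q"] by (simp add: D1_uminus adj_uminus)

lemma D1_adj: "P \<in> D1 \<Longrightarrow> adj P \<in> D1"
proof (induction rule: D1_add_induct)
  case (dmon f k)
  show ?case by (simp add: adj_dmon D1_mult D1_power D1_uminus D1_dpartial D1_dfun)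
qed (simp add: adj_add D1_add)

text \<open>Induction over the generators of \<open>P\<close> reduces the claim to functions and
  \<open>dpartial\<close>. There additivity in \<open>Q\<close> leaves only monomials, where it
  follows from the Leibniz rule.\<close>

lemma adj_mult: assumes "P \<in> D1" "Q \<in> D1" shows "adj (P * Q) = adj Q * adj P"
proof -
  have dfun_Q: "adj (dfun f * Q) = adj Q * dfun f" if "Q \<in> D1" for f and Q :: "'a dsym"
    using that
  proof (induction rule: D1_add_induct)
    case (dmon g k)
    show ?case by (simp add: dfun_mult_dmon adj_dmon mult.commute[of f] dfun_mult mult.assoc)
  qed (simp add: distrib_left distrib_right adj_add D1_dfun_mult)
  have dpartial_Q: "adj (dpartial * Q) = - (adj Q * dpartial)" if "Q \<in> D1" for Q :: "'a dsym"
    using that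
  proof (induction rule: D1_add_induct)
    case (dmon g k)
    have "adj (dpartial * dmon g k) = (- dpartial) ^ k * (- (dpartial * dfun g) + dfun (fps_deriv g))"
      by (simp add: dpartial_mult_dmon adj_add D1_dmon adj_dmon power_commutes distrib_left right_diff_distrib mult.assoc
          del: power_Suc add: power_Suc2)
    also have "- (dpartial * dfun g) + dfun (fps_deriv g) = - (dfun g * dpartial)"
      by (simp add: dpartial_dfun)
    finally show ?case by (simp add: adj_dmon mult.assoc)
  qed (simp add: distrib_left distrib_right adj_add D1_dpartial_mult)
  have "\<forall>Q\<in>D1. adj (P * Q) = adj Q * adj P"
    using assms(1)
  proof (induction rule: D1_induct)
    case (mult P1 P2)
    then show ?case by (simp add: mult.assoc D1_mult)
  qed (simp_all add: dfun_Q dpartial_Q adj_dfun adj_dpartial distrib_right distrib_left adj_add D1_mult)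
  then show ?thesis using assms(2) by blast
qed

lemma adj_power: "P \<in> D1 \<Longrightarrow> adj (P ^ n) = adj P ^ n"
  by (induction n) (simp_all add: adj_1 adj_mult D1_power power_commutes)

lemma adj_adj: "P \<in> D1 \<Longrightarrow> adj (adj P) = P"
  by (induction rule: D1_induct)
    (simp_all add: adj_dfun adj_dpartial adj_uminus D1_dpartial adj_add adj_mult D1_adj)

section \<open>Order and degree under the adjoint\<close>

lemma ordle_dmon: "ordle (dmon f k) d \<longleftrightarrow> val_ge (int k - d) f"
  unfolding ordle_val_ge_coeff dcoeff_dmon by (auto simp: val_ge_def)

lemma ordle_dpartial_power: "ordle (dpartial ^ k :: 'a::field_char_0 dsym) (int k)"
  by (simp add: ordle_def dcoeff_dpartial_power)

lemma ordle_neg_dpartial_power: "ordle ((- dpartial) ^ k :: 'a::field_char_0 dsym) (int k)"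
  using ordle_dpartial_power[where 'a = 'a, of k] by (cases "even k") (simp_all add: ordle_uminus)

lemma ordle_adj:
  assumes "P \<in> D1" "ordle P d" shows "ordle (adj P) d"
proof -
  obtain N where "\<forall>k\<ge>N. dcoeff P k = 0" using assms(1) D1_iff by metis
  then have "adj P = (\<Sum>k<N. (- dpartial) ^ k * dfun (dcoeff P k))" by (rule adj_eq_sum)
  moreover have "ordle ((- dpartial) ^ k * dfun (dcoeff P k)) d" for k
  proof -
    have "ordle (dmon (dcoeff P k) 0) (d - int k)"
      unfolding ordle_dmon using assms(2) by (simp add: ordle_val_ge_coeff)
    then show ?thesis
      using ordle_mult[OF ordle_neg_dpartial_power[of k], of "dfun (dcoeff P k)" "d - int k"]
      by (simp add: dmon_def)
  qed
  ultimately show ?thesis by (simp add: ordle_sum)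
qed

lemma ordle_adj_iff: "P \<in> D1 \<Longrightarrow> ordle (adj P) d \<longleftrightarrow> ordle P d"
  by (metis D1_adj adj_adj ordle_adj)

lemma dcoeff_dpartial_power_mult_eq_0:
  fixes P :: "'a::field_char_0 dsym"
  assumes "\<forall>k>N. dcoeff P k = 0" "n > N + m"
  shows "dcoeff (dpartial ^ m * P) n = 0"
  using assms(2)
proof (induction m arbitrary: n)
  case (Suc m)
  then show ?case by (simp add: mult.assoc dcoeff_dpartial_mult)
qed (use assms(1) in simp)

lemma dcoeff_adj_eq_0:
  fixes P :: "'a::field_char_0 dsym"
  assumes "\<forall>k\<ge>N. dcoeff P k = 0" "n \<ge> N"
  shows "dcoeff (adj P) n = 0"
proof -
  have "dcoeff ((- dpartial) ^ k * dfun f) n = 0" if "k < N" for k and f :: "'a fps"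
    using dcoeff_dpartial_power_mult_eq_0[of 0 "dfun f" k n] that assms(2)
    by (cases "even k") (simp_all add: dcoeff_simps)
  then show ?thesis by (simp add: adj_eq_sum[OF assms(1)] dcoeff_sum)
qed

lemma dord_le_iff:
  assumes "P \<in> D1" shows "dord P \<le> N \<longleftrightarrow> (\<forall>k>N. dcoeff P k = 0)"
proof (cases "P = 0")
  case False
  then have "{k. dcoeff P k \<noteq> 0} \<noteq> {}"
    using dsym_coeff_eqI[of P 0] by (auto simp: dcoeff_simps)
  then show ?thesis
    using assms False unfolding dord_def D1_def by (auto simp: not_le[symmetric])
qed (simp add: dord_def dcoeff_simps)

lemma dord_eqI:
  assumes "P \<in> D1" "Q \<in> D1" "\<And>N. (\<forall>k\<ge>N. dcoeff P k = 0) \<longleftrightarrow> (\<forall>k\<ge>N. dcoeff Q k = 0)"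
  shows "dord P = dord Q"
  using assms by (metis dord_le_iff le_antisym order_refl Suc_le_eq)

lemma dord_adj: "P \<in> D1 \<Longrightarrow> dord (adj P) = dord P"
  by (rule dord_eqI) (simp_all add: D1_adj, metis adj_adj dcoeff_adj_eq_0)

lemma dord_uminus: "dord (- P) = dord P"
  by (simp add: dord_def dcoeff_simps)

lemma bord_mono:
  assumes "\<And>d. ordle P d \<Longrightarrow> ordle Q d"
  shows "bord Q \<le> bord P"
  unfolding bord_def[of Q]
proof (rule SUP_least)
  fix k assume "k \<in> {k. dcoeff Q k \<noteq> 0}"
  then have "dcoeff Q k $ subdegree (dcoeff Q k) \<noteq> 0" by simp
  \<comment> \<open>The bound is one below the value attained at \<open>k\<close>, so it fails for
    \<open>Q\<close> and hence for \<open>P\<close>.\<close>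
  then have "\<not> ordle Q (int k - int (subdegree (dcoeff Q k)) - 1)"
    unfolding ordle_def by (intro notI) (drule spec, drule spec, drule (1) mp, simp)
  then have "\<not> ordle P (int k - int (subdegree (dcoeff Q k)) - 1)" using assms by blast
  then obtain l i where l: "dcoeff P l $ i \<noteq> 0" "int k - int (subdegree (dcoeff Q k)) \<le> int l - int i"
    unfolding ordle_def by force
  then have "subdegree (dcoeff P l) \<le> i" by (intro subdegree_leI)
  then have "real k - real (subdegree (dcoeff Q k)) \<le> real l - real (subdegree (dcoeff P l))"
    using l(2) by linarith
  moreover have "l \<in> {k. dcoeff P k \<noteq> 0}" using l(1) by auto
  ultimately show "ereal (real k - real (subdegree (dcoeff Q k))) \<le> bord P"
    unfolding bord_def by (intro SUP_upper2[of l]) simp_all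
qed

lemma bord_cong:
  assumes "\<And>d. ordle P d \<longleftrightarrow> ordle Q d"
  shows "bord P = bord Q"
  by (intro antisym bord_mono) (simp_all add: assms)

lemma bord_adj: "P \<in> D1 \<Longrightarrow> bord (adj P) = bord P"
  by (rule bord_cong) (rule ordle_adj_iff)

lemma bord_uminus: "bord (- P) = bord P"
  by (rule bord_cong) (rule ordle_uminus)

lemma bord_leI:
  assumes "ordle P d" shows "bord P \<le> ereal (of_int d)"
  unfolding bord_def
proof (rule SUP_least)
  fix k assume "k \<in> {k. dcoeff P k \<noteq> 0}"
  then have "dcoeff P k $ subdegree (dcoeff P k) \<noteq> 0" by simp
  then have "int k \<le> int (subdegree (dcoeff P k)) + d" using assms unfolding ordle_def by blast
  then show "ereal (real k - real (subdegree (dcoeff P k))) \<le> ereal (of_int d)" by simp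
qed

lemma bord_leD:
  assumes "bord P \<le> ereal (of_int d)" shows "ordle P d"
  unfolding ordle_def
proof (intro allI impI)
  fix k i assume nz: "dcoeff P k $ i \<noteq> 0"
  then have "ereal (real k - real (subdegree (dcoeff P k))) \<le> bord P"
    unfolding bord_def by (intro SUP_upper) auto
  also note assms
  finally have "real k - real (subdegree (dcoeff P k)) \<le> of_int d" by simp
  moreover have "subdegree (dcoeff P k) \<le> i" using nz by (rule subdegree_leI)
  ultimately show "int k \<le> int i + d" by linarith
qed

lemma bord_geI:
  assumes "dcoeff P k $ i \<noteq> 0" shows "ereal (real k - real i) \<le> bord P"
proof -
  have "subdegree (dcoeff P k) \<le> i" using assms by (rule subdegree_leI)
  then show ?thesis
    unfolding bord_def using assms by (intro SUP_upper2[of k]) auto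
qed

section \<open>The bilinear concomitant at the origin\<close>

text \<open>
  For \<open>L\<close> in \<open>D1\<close>, the function \<open>v * dact L u - dact (adj L) v * u\<close> is the derivative of a
  bilinear differential expression in \<open>u\<close> and \<open>v\<close> (Lagrange's identity); \<open>concom L u v\<close> is the
  value of that expression at $x = 0$, and \<open>bdry k\<close> is the case $L = \partial^k$.
\<close>

fun bdry :: "nat \<Rightarrow> 'a::field_char_0 fps \<Rightarrow> 'a fps \<Rightarrow> 'a" where
  "bdry 0 u v = 0"
| "bdry (Suc k) u v = jet k u * jet 0 v - bdry k u (fps_deriv v)"

lemma bdry_add: "bdry k (u + u') v = bdry k u v + bdry k u' v" "bdry k u (v + v') = bdry k u v + bdry k u v'"
  by (induction k arbitrary: v v') (simp_all add: jet_simps algebra_simps)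

lemma bdry_scale: "bdry k (fps_const c * u) v = c * bdry k u v" "bdry k u (fps_const c * v) = c * bdry k u v"
  by (induction k arbitrary: v)
    (simp_all add: jet_simps right_diff_distrib mult.assoc mult.left_commute[of _ c])

lemma bdry_0: "bdry k 0 v = 0" "bdry k u 0 = 0"
  using bdry_scale[where c = 0] by simp_all

lemma bdry_uminus: "bdry k (- u) v = - bdry k u v" "bdry k u (- v) = - bdry k u v"
  using bdry_add(1)[of k u "- u" v] bdry_add(2)[of k u v "- v"] by (simp_all add: bdry_0 eq_neg_iff_add_eq_0 add.commute)

definition concom :: "'a::field_char_0 dsym \<Rightarrow> 'a fps \<Rightarrow> 'a fps \<Rightarrow> 'a" where
  "concom L u v = (\<Sum>k | dcoeff L k \<noteq> 0. bdry k u (dcoeff L k * v))"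

lemma concom_eq_sum:
  assumes "\<forall>k\<ge>N. dcoeff L k = 0"
  shows "concom L u v = (\<Sum>k<N. bdry k u (dcoeff L k * v))"
  unfolding concom_def
proof (rule sum.mono_neutral_left)
  show "{k. dcoeff L k \<noteq> 0} \<subseteq> {..<N}" using assms by (auto simp: not_less[symmetric])
qed (auto simp: bdry_0)

lemma concom_dmon: "concom (dmon f k) u v = bdry k u (f * v)"
  by (subst concom_eq_sum[of "Suc k"]) (simp_all add: dcoeff_dmon bdry_0)

lemma concom_add:
  assumes "L \<in> D1" "M \<in> D1" shows "concom (L + M) u v = concom L u v + concom M u v"
proof -
  obtain N N' where "\<forall>k\<ge>N. dcoeff L k = 0" "\<forall>k\<ge>N'. dcoeff M k = 0"
    using assms D1_iff by metis
  then have *: "\<forall>k\<ge>max N N'. dcoeff L k = 0" "\<forall>k\<ge>max N N'. dcoeff M k = 0" by auto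
  then have "\<forall>k\<ge>max N N'. dcoeff (L + M) k = 0" by (simp add: dcoeff_simps)
  then show ?thesis
    using *[THEN concom_eq_sum] concom_eq_sum[of "max N N'" "L + M"]
    by (simp add: dcoeff_simps distrib_right bdry_add sum.distrib)
qed

lemma concom_dfun: "concom (dfun f) u v = 0"
  using concom_dmon[of f 0 u v] by (simp add: dmon_def)

lemma concom_dpartial: "concom dpartial u v = jet 0 u * jet 0 v"
  using concom_dmon[of 1 1 u v] by (simp add: dmon_def dfun_1)

lemma concom_add_left: "concom L (u + u') v = concom L u v + concom L u' v"
  by (simp add: concom_def bdry_add sum.distrib)

lemma concom_add_right: "concom L u (v + v') = concom L u v + concom L u v'"
  by (simp add: concom_def bdry_add distrib_left sum.distrib)

lemma concom_scale_left: "concom L (fps_const c * u) v = c * concom L u v"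
  by (simp add: concom_def bdry_scale sum_distrib_left)

lemma concom_scale_right: "concom L u (fps_const c * v) = c * concom L u v"
  by (simp add: concom_def bdry_scale sum_distrib_left mult.left_commute[of _ "fps_const c"])

lemma concom_0_left: "concom L 0 v = 0"
  by (simp add: concom_def bdry_0)

lemma concom_0_right: "concom L u 0 = 0"
  by (simp add: concom_def bdry_0)

lemma concom_uminus_right: "concom L u (- v) = - concom L u v"
  by (simp add: concom_def bdry_uminus sum_negf)

text \<open>Insert \<open>dact (adj L) v * dact M u\<close> into Lagrange's difference for
  \<open>L * M\<close>: it splits into the difference for \<open>L\<close> at
  \<open>dact M u\<close>, \<open>v\<close> and the one for \<open>M\<close> at \<open>u\<close>,
  \<open>dact (adj L) v\<close>. The proof checks this on generators of \<open>L\<close>.\<close>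

lemma concom_mult:
  assumes "L \<in> D1" "M \<in> D1"
  shows "concom (L * M) u v = concom L (dact M u) v + concom M u (dact (adj L) v)"
proof -
  have dfun_M: "concom (dfun f * M) u v = concom M u (f * v)" if "M \<in> D1" for f M and u v :: "'a fps"
    using that
  proof (induction rule: D1_add_induct)
    case (dmon g k)
    show ?case by (simp add: dfun_mult_dmon concom_dmon mult_ac)
  qed (simp add: distrib_left concom_add D1_dfun_mult)
  have dpartial_M: "concom (dpartial * M) u v = jet 0 (dact M u) * jet 0 v - concom M u (fps_deriv v)"
    if "M \<in> D1" for M and u v :: "'a fps"
    using that
  proof (induction rule: D1_add_induct)
    case (dmon g k)
    have "dact (dmon g k) u $ 0 = g $ 0 * jet k u"
      by (simp add: dmon_def dact_mult dact_dfun dact_dpartial_power jet_deriv_funpow)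
    then show ?case
      by (simp add: dpartial_mult_dmon concom_add D1_dmon concom_dmon bdry_add jet_def mult_ac)
  qed (simp add: distrib_left distrib_right concom_add D1_dpartial_mult dact_add jet_simps)
  have "\<forall>M\<in>D1. \<forall>u v. concom (L * M) u v = concom L (dact M u) v + concom M u (dact (adj L) v)"
    using assms(1)
  proof (induction rule: D1_induct)
    case (dfun f)
    show ?case by (simp add: dfun_M concom_dfun adj_dfun dact_dfun)
  next
    case dpartial
    show ?case by (simp add: dpartial_M concom_dpartial adj_dpartial dact_uminus dact_dpartial concom_uminus_right)
  next
    case (add L1 L2)
    then show ?case
      by (simp add: distrib_right concom_add D1_mult adj_add dact_add concom_add_right)
  next
    case (mult L1 L2)
    then show ?case by (simp add: mult.assoc D1_mult adj_mult dact_mult)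
  qed
  then show ?thesis using assms(2) by blast
qed

text \<open>\<open>bdry k u v\<close> is an alternating sum of products
  \<open>jet i u * jet j v\<close> with i + j = k - 1, and in each of them i < m or j < n.\<close>

lemma bdry_val_ge: "val_ge m u \<Longrightarrow> val_ge n v \<Longrightarrow> int k \<le> m + n \<Longrightarrow> bdry k u v = 0"
proof (induction k arbitrary: n v)
  case (Suc k)
  have "bdry k u (fps_deriv v) = 0"
    using Suc.prems val_ge_deriv_funpow[of n v 1] by (intro Suc.IH[of "n - 1"]) simp_all
  moreover have "jet k u * jet 0 v = 0"
    using Suc.prems jet_val_ge[of m u k] jet_val_ge[of n v 0] by (cases "int k < m") simp_all
  ultimately show ?case by simp
qed simp

text \<open>The form pairs index \<open>n\<close> with \<open>p - 1 - n\<close> and is blind to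
  indices from \<open>p\<close> on; the reflected indices below originate here.\<close>

lemma bdry_expb_right: "bdry p u (expb n) = (if n < p then (-1) ^ n * jet (p - 1 - n) u else 0)"
proof (induction p arbitrary: n)
  case (Suc p)
  show ?case
  proof (cases n)
    case (Suc m)
    then show ?thesis by (simp add: Suc.IH fps_deriv_expb jet_expb)
  qed (simp add: fps_deriv_expb jet_expb bdry_0)
qed simp

lemma bdry_expb_left: "bdry p (expb m) v = (if m < p then (-1) ^ (p - 1 - m) * jet (p - 1 - m) v else 0)"
proof (induction p arbitrary: v)
  case (Suc p)
  show ?case
  proof (cases "m < p")
    case True
    then have "p - m = Suc (p - 1 - m)" by simp
    then show ?thesis using True jet_deriv[of "p - Suc m" 1 v] by (simp add: Suc.IH jet_expb)
  qed (auto simp: Suc.IH jet_expb)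
qed simp

section \<open>Unitriangular operators and the dual Schur operator\<close>

definition monic :: "nat \<Rightarrow> 'a::field_char_0 dsym \<Rightarrow> bool" where
  "monic p P \<longleftrightarrow> (\<forall>k>p. dcoeff P k = 0) \<and> dcoeff P p = 1"

lemma monic_D1: "monic p P \<Longrightarrow> P \<in> D1"
  unfolding monic_def D1_iff by (meson Suc_le_lessD)

lemma monic_ordle_diff:
  assumes "monic p P" shows "ordle (P - dpartial ^ p) (int p - 1)"
  unfolding ordle_def
proof (intro allI impI)
  fix k i assume "dcoeff (P - dpartial ^ p) k $ i \<noteq> 0"
  then have "k < p"
    using assms unfolding monic_def
    by (cases k p rule: linorder_cases) (simp_all add: dcoeff_simps dcoeff_dpartial_power)
  then show "int k \<le> int i + (int p - 1)" by simp
qed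

lemma monic_ordle: assumes "monic p P" shows "ordle P (int p)"
  using ordle_add[OF ordle_mono[OF monic_ordle_diff[OF assms]] ordle_dpartial_power[of p]] by simp

text \<open>Each term of degree k < p vanishes by \<open>bdry_val_ge\<close>, since k \<le> p - 1
  \<le> m + n; only the top term has degree large enough to survive.\<close>

lemma concom_top:
  assumes "monic p P" "val_ge m u" "val_ge n v" "int p - 1 \<le> m + n"
  shows "concom P u v = bdry p u v"
proof -
  have "concom P u v = (\<Sum>k<Suc p. bdry k u (dcoeff P k * v))"
    using assms(1) by (intro concom_eq_sum) (simp add: monic_def)
  also have "\<dots> = (\<Sum>k<p. bdry k u (dcoeff P k * v)) + bdry p u v"
    using assms(1) by (simp add: monic_def)
  also have "(\<Sum>k<p. bdry k u (dcoeff P k * v)) = 0"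
    using assms by (intro sum.neutral ballI bdry_val_ge[of m _ n] val_ge_mult_left) auto
  finally show ?thesis by simp
qed

text \<open>The identity plus an operator that strictly raises valuations; \<open>unitri_iff\<close>
  relates it to the conditions on a monic Schur operator.\<close>

definition unitri :: "'a::field_char_0 dsym \<Rightarrow> bool" where
  "unitri S \<longleftrightarrow> ordle (S - 1) (-1)"

lemma unitri_ordle: "unitri S \<Longrightarrow> ordle S 0"
  unfolding unitri_def using ordle_add[OF ordle_mono[of "S - 1" "-1" 0] ordle_1] by simp

lemma unitri_dact_diff: "unitri S \<Longrightarrow> val_ge n u \<Longrightarrow> val_ge (n + 1) (dact S u - u)"
  unfolding unitri_def using ordle_dact[of "S - 1" "-1" n u] by (simp add: dact_diff dact_1)

lemma unitri_dact: "unitri S \<Longrightarrow> val_ge n u \<Longrightarrow> val_ge n (dact S u)"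
  using ordle_dact[OF unitri_ordle, of S n u] by simp

section \<open>Triangular systems of linear functionals\<close>

definition linfun :: "('a::field_char_0 fps \<Rightarrow> 'a) \<Rightarrow> bool" where
  "linfun \<psi> \<longleftrightarrow> (\<forall>f g. \<psi> (f + g) = \<psi> f + \<psi> g) \<and> (\<forall>c f. \<psi> (fps_const c * f) = c * \<psi> f)"

lemma linfun_sum:
  assumes "linfun \<psi>" shows "\<psi> (\<Sum>x\<in>A. fps_const (c x) * f x) = (\<Sum>x\<in>A. c x * \<psi> (f x))"
proof -
  have "\<psi> 0 = 0" using assms unfolding linfun_def by (metis fps_const_0_eq_0 mult_zero_left)
  then show ?thesis
    using assms by (induction A rule: infinite_finite_induct) (simp_all add: linfun_def)
qed

lemma linfun_truncate:
  assumes "linfun \<psi>" "\<And>f. val_ge (int N) f \<Longrightarrow> \<psi> f = 0"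
  shows "\<psi> f = (\<Sum>i<N. jet i f * \<psi> (expb i))"
proof -
  let ?g = "\<Sum>i<N. fps_const (jet i f) * expb i"
  have "\<psi> f = \<psi> ((f - ?g) + ?g)" by simp
  also have "\<dots> = \<psi> (f - ?g) + \<psi> ?g" using assms(1) unfolding linfun_def by blast
  finally show ?thesis using assms(2)[OF fps_truncate] linfun_sum[OF assms(1)] by simp
qed

text \<open>The matrix of these functionals on \<open>expb\<close> is lower triangular with nonzero
  diagonal, so forward substitution solves the system uniquely. The instances are the jets of
  \<open>dact S\<close>, for inverting \<open>S\<close>, and the concomitants that define the dual
  Schur operator.\<close>

locale triangular =
  fixes \<phi> :: "nat \<Rightarrow> 'a::field_char_0 fps \<Rightarrow> 'a"
  assumes lin: "linfun (\<phi> j)"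
    and vanish: "val_ge (int j + 1) f \<Longrightarrow> \<phi> j f = 0"
    and diag: "\<phi> j (expb j) \<noteq> 0"
begin

lemma functional_eq_sum: "\<phi> j f = (\<Sum>i<j. jet i f * \<phi> j (expb i)) + jet j f * \<phi> j (expb j)"
  using linfun_truncate[OF lin[of j], of "Suc j" f] vanish by (simp add: add.commute)

lemma val_ge_functional: "val_ge (int j) f \<Longrightarrow> \<phi> j f = jet j f * \<phi> j (expb j)"
  using functional_eq_sum[of j f] by (simp add: jet_val_ge)

lemma val_geI:
  assumes "\<And>j. j < n \<Longrightarrow> \<phi> j f = 0" shows "val_ge (int n) f"
proof -
  have "jet j f = 0" if "j < n" for j
    using that
  proof (induction j rule: less_induct)
    case (less j)
    have "f $ i = 0" if "i < j" for i using less.IH[of i] that less.prems by (simp add: jet_def)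
    then have "val_ge (int j) f" by (simp add: val_ge_def)
    then show ?case using val_ge_functional assms[OF less.prems] diag by simp
  qed
  then show ?thesis by (simp add: val_ge_def jet_def)
qed

lemma eqI: assumes "\<And>j. \<phi> j f = \<phi> j g" shows "f = g"
proof -
  have "\<phi> j (f - g) = 0" for j
  proof -
    have "\<phi> j (f - g) + \<phi> j g = \<phi> j ((f - g) + g)" using lin unfolding linfun_def by metis
    then show ?thesis using assms by simp
  qed
  then have "val_ge (int n) (f - g)" for n by (rule val_geI)
  then have "(f - g) $ i = 0" for i by (auto simp: val_ge_def)
  then show ?thesis by (simp add: fps_eq_iff)
qed

lemma solve: "\<exists>f. \<forall>j. \<phi> j f = r j"
proof -
  define R where "R = (\<lambda>(c :: nat \<Rightarrow> 'a) j. (r j - (\<Sum>i<j. c i * \<phi> j (expb i))) / \<phi> j (expb j))"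
  define c where "c = wfrec {(i, j). i < j} R"
  have adm: "adm_wf {(i, j). i < j} R"
    unfolding adm_wf_def R_def by (auto intro!: sum.cong)
  have "c = R c"
    unfolding c_def by (rule wfrec_fixpoint) (use adm wf_less in auto)
  then have c: "c j * \<phi> j (expb j) = r j - (\<Sum>i<j. c i * \<phi> j (expb i))" for j
    using diag by (metis R_def nonzero_divide_eq_eq)
  \<comment> \<open>The recursion produces jets, hence the division by the factorial in the
    coefficients.\<close>
  have "jet j (Abs_fps (\<lambda>i. c i / fact i)) = c j" for j by (simp add: jet_def)
  then have "\<phi> j (Abs_fps (\<lambda>i. c i / fact i)) = r j" for j
    unfolding functional_eq_sum[of j "Abs_fps _"] by (simp add: c)
  then show ?thesis by blast
qed

end

lemma linfun_dact: "linfun \<psi> \<Longrightarrow> linfun (\<lambda>f. \<psi> (dact P f))"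
  by (simp add: linfun_def dact_add_right dact_scale)

lemma linfun_concom: "linfun (concom L u)" "linfun (\<lambda>u. concom L u v)"
  by (simp_all add: linfun_def concom_add_left concom_add_right concom_scale_left concom_scale_right)

lemma linfun_bdry: "linfun (bdry k u)" "linfun (\<lambda>u. bdry k u v)"
  by (simp_all add: linfun_def bdry_add bdry_scale)

lemma linfun_jet: "linfun (jet n)"
  by (simp add: linfun_def jet_simps)

section \<open>Inverses of unitriangular operators\<close>

lemma unitri_of_images:
  assumes "\<And>n. val_ge (int n + 1) (v n - expb n)"
  shows "\<exists>S. unitri S \<and> (\<forall>n. dact S (expb n) = v n)"
proof -
  obtain N where "ordle N (-1)" "\<And>n. dact N (expb n) = v n - expb n"
    using dsym_of_images[of "-1" "\<lambda>n. v n - expb n"] assms by auto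
  then show ?thesis
    by (intro exI[of _ "1 + N"]) (simp add: unitri_def dact_add dact_1)
qed

lemma unitri_right_inverse:
  assumes "unitri S" shows "\<exists>T. unitri T \<and> S * T = 1"
proof -
  interpret triangular "\<lambda>j f. jet j (dact S f)"
  proof
    fix j :: nat and f :: "'a fps"
    show "linfun (\<lambda>f. jet j (dact S f))" by (rule linfun_dact[OF linfun_jet])
    show "jet j (dact S f) = 0" if "val_ge (int j + 1) f"
      using unitri_dact[OF assms that] by (simp add: jet_val_ge)
    show "jet j (dact S (expb j)) \<noteq> 0"
      using jet_val_ge[OF unitri_dact_diff[OF assms val_ge_expb], of j j] by (simp add: jet_simps jet_expb)
  qed
  have "\<exists>f. dact S f = expb n" for n
    using solve[of "\<lambda>j. jet j (expb n)"] fps_eq_jetI by metis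
  then obtain v where v: "\<And>n. dact S (v n) = expb n" by metis
  have "val_ge (int n + 1) (v n - expb n)" for n
  proof -
    have *: "val_ge (int n) (v n)" by (rule val_geI) (simp add: v jet_expb)
    show ?thesis using unitri_dact_diff[OF assms *] by (simp add: v val_ge_def)
  qed
  then obtain T where T: "unitri T" "\<And>n. dact T (expb n) = v n" using unitri_of_images by metis
  moreover have "S * T = 1" by (rule dsym_eq_expb) (simp add: dact_mult T v dact_1)
  ultimately show ?thesis by blast
qed

text \<open>The right inverse is again unitriangular, so it has a right inverse of its own, which by
  associativity is \<open>S\<close>.\<close>

lemma unitri_invertible:
  assumes "unitri S" shows "\<exists>T. is_dinv S T"
proof -
  obtain T where T: "unitri T" "S * T = 1" using unitri_right_inverse[OF assms] by blast
  obtain S' where S': "T * S' = 1" using unitri_right_inverse[OF T(1)] by blast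
  have "S' = (S * T) * S'" by (simp add: T)
  also have "\<dots> = S" by (simp add: mult.assoc S')
  finally show ?thesis using T S' by (auto simp: is_dinv_def)
qed

lemma is_dinv_dinv: assumes "is_dinv S T" shows "dinv S = T"
  unfolding dinv_def
proof (rule the_equality)
  show "is_dinv S T" by (rule assms)
next
  fix U assume "is_dinv S U"
  then have "U = U * (S * T)" "(U * S) * T = T" using assms by (simp_all add: is_dinv_def)
  then show "U = T" by (simp add: mult.assoc)
qed

lemma dinv_mult: assumes "\<exists>T. is_dinv S T" shows "S * dinv S = 1" "dinv S * S = 1"
  using assms is_dinv_dinv is_dinv_def by metis+

text \<open>
  For $p = \mathrm{ord}(P)$ the adjoint pair is \<open>(sadj p P, sadj (Suc p) Q)\<close> in both parities of $p$.
\<close>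

definition sadj :: "nat \<Rightarrow> 'a::field_char_0 dsym \<Rightarrow> 'a dsym" where
  "sadj k P = (- 1) ^ k * adj P"

lemma monic_power_ordle: assumes "monic p P" shows "ordle (P ^ k) (int (p * k))"
proof (induction k)
  case (Suc k)
  then show ?case using ordle_mult[OF monic_ordle[OF assms], of "P ^ k" "int (p * k)"] by simp
qed (simp add: ordle_1)

text \<open>Each factor \<open>P\<close> acts as \<open>dpartial ^ p\<close>, lowering the index by
  \<open>p\<close>, plus an operator lowering valuations by at most \<open>p - 1\<close>, which only
  affects higher terms.\<close>

lemma monic_power_dact:
  assumes "monic p P"
  shows "val_ge (int r + 1) (dact (P ^ k) (expb (r + p * k)) - expb r)"
proof (induction k)
  case 0
  show ?case by (simp add: dact_1 val_ge_def)
next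
  case (Suc k)
  let ?e = "expb (r + p * Suc k) :: 'a fps"
  have "val_ge (int (r + p * Suc k) - (int p - 1)) (dact (P - dpartial ^ p) ?e)"
    by (rule ordle_dact[OF monic_ordle_diff[OF assms] val_ge_expb])
  then have "val_ge (int (r + p * Suc k) - (int p - 1) - int (p * k)) (dact (P ^ k) (dact (P - dpartial ^ p) ?e))"
    by (rule ordle_dact[OF monic_power_ordle[OF assms]])
  then have "val_ge (int r + 1) (dact (P ^ k) (dact (P - dpartial ^ p) ?e))" by (simp add: algebra_simps)
  moreover have "dact (P ^ k) (dact (P - dpartial ^ p) ?e) =
      dact (P ^ Suc k) ?e - dact (P ^ k) (expb (r + p * k))"
    by (simp add: dact_diff dact_dpartial_power fps_deriv_funpow_expb dact_diff_right dact_mult[symmetric] power_commutes)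
  ultimately show ?case using Suc val_ge_add by fastforce
qed

text \<open>
  The operator \<open>T\<close> is found by solving, for each \<open>n\<close>, the triangular system that prescribes the values
  at $y = T(x^n/n!)$ of the functionals $y \mapsto$ \<open>concom P (dact S (expb (p - 1 - r))) (dact (P' ^ k) y)\<close>,
  $0 \le r < p$. The one with index $j = r + pk$ has leading term $(-1)^r y^{(j)}(0)$.
\<close>

lemma dual_schur:
  fixes P S :: "'a::field_char_0 dsym"
  assumes p: "0 < p" and P: "monic p P" and S: "unitri S" and P': "monic p P'"
  shows "\<exists>T. unitri T \<and> P' * T = T * dpartial ^ p \<and>
    (\<forall>w z. concom P (dact S w) (dact T z) = bdry p w z)"
proof -
  \<comment> \<open>\<open>expb (p - 1 - r)\<close> is the partner of \<open>expb r\<close> under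
    \<open>bdry p\<close>; for j = r + p k, the power \<open>P' ^ k\<close> brings index
    \<open>j\<close> down to \<open>r\<close>.\<close>
  define \<phi> where "\<phi> j y = concom P (dact S (expb (p - 1 - j mod p))) (dact (P' ^ (j div p)) y)" for j y
  have vS: "val_ge (int (p - 1 - j mod p)) (dact S (expb (p - 1 - j mod p)))" for j
    by (rule unitri_dact[OF S val_ge_expb])
  have int_p: "int (p - 1 - j mod p) = int p - 1 - int (j mod p)" for j
    using mod_less_divisor[OF p, of j] by linarith
  have split: "int j = int (j mod p) + int (p * (j div p))" for j
    by (metis mod_mult_div_eq of_nat_add)
  have \<phi>_diag: "\<phi> j (expb j) = (- 1) ^ (j mod p)" for j
  proof -
    let ?r = "j mod p"
    let ?f = "dact (P' ^ (j div p)) (expb j)"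
    have f: "val_ge (int ?r + 1) (?f - expb ?r)"
      using monic_power_dact[OF P', of ?r "j div p"] by (simp only: mod_mult_div_eq)
    then have vf: "val_ge (int ?r) ?f"
      using val_ge_add[OF val_ge_mono[OF f] val_ge_expb, of ?r] by simp
    have "\<phi> j (expb j) = bdry p (dact S (expb (p - 1 - ?r))) ?f"
      unfolding \<phi>_def by (rule concom_top[OF P vS vf]) (simp add: int_p)
    also have "\<dots> = bdry p (dact S (expb (p - 1 - ?r)) - expb (p - 1 - ?r) + expb (p - 1 - ?r)) ?f" by simp
    also have "\<dots> = bdry p (expb (p - 1 - ?r)) ?f"
      unfolding bdry_add
      using bdry_val_ge[OF unitri_dact_diff[OF S val_ge_expb[of "p - 1 - ?r"]] vf, of p] by (simp add: int_p)
    also have "\<dots> = bdry p (expb (p - 1 - ?r)) (?f - expb ?r + expb ?r)" by simp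
    also have "\<dots> = bdry p (expb (p - 1 - ?r)) (expb ?r)"
      unfolding bdry_add using bdry_val_ge[OF val_ge_expb[of "p - 1 - ?r"] f, of p] by (simp add: int_p)
    also have "\<dots> = (- 1) ^ ?r"
      using mod_less_divisor[OF p, of j] by (simp add: bdry_expb_right jet_expb)
    finally show ?thesis .
  qed
  interpret triangular \<phi>
  proof
    fix j f
    show "linfun (\<phi> j)" unfolding \<phi>_def by (rule linfun_dact[OF linfun_concom(1)])
    show "\<phi> j f = 0" if "val_ge (int j + 1) f"
    proof -
      have v: "val_ge (int j + 1 - int (p * (j div p))) (dact (P' ^ (j div p)) f)"
        by (rule ordle_dact[OF monic_power_ordle[OF P'] that])
      have "\<phi> j f = bdry p (dact S (expb (p - 1 - j mod p))) (dact (P' ^ (j div p)) f)"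
        unfolding \<phi>_def by (rule concom_top[OF P vS v]) (use split[of j] in \<open>simp add: int_p\<close>)
      also have "\<dots> = 0"
        by (rule bdry_val_ge[OF vS v]) (use split[of j] in \<open>simp add: int_p\<close>)
      finally show ?thesis .
    qed
    show "\<phi> j (expb j) \<noteq> 0" unfolding \<phi>_diag by simp
  qed
  \<comment> \<open>These values are forced: with j = r + p k, the desired properties of
    \<open>T\<close> turn \<open>\<phi> j (dact T (expb n))\<close> into
    \<open>bdry p (expb (p - 1 - r)) ((fps_deriv ^^ (p * k)) (expb n))\<close>.\<close>
  obtain v where v: "\<And>n j. \<phi> j (v n) = (if j = n then (- 1) ^ (j mod p) else 0)"
    using solve[of "\<lambda>j. if j = _ then (- 1) ^ (j mod p) else 0"] by metis
  have "val_ge (int n + 1) (v n - expb n)" for n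
  proof -
    have vn: "val_ge (int n) (v n)" by (rule val_geI) (simp add: v)
    have "jet n (v n) = 1" using val_ge_functional[OF vn] by (simp add: v \<phi>_diag)
    then have "v n $ n = expb n $ n" by (simp add: jet_def expb_nth field_simps)
    then show ?thesis using vn by (auto simp: val_ge_def expb_nth)
  qed
  then obtain T where T: "unitri T" "\<And>n. dact T (expb n) = v n" using unitri_of_images by metis
  have comm: "P' * T = T * dpartial ^ p"
  proof (rule dsym_eq_expb, rule eqI)
    fix n j
    \<comment> \<open>One more factor \<open>P'\<close> raises the index j by \<open>p\<close> and
      keeps its residue, while \<open>dpartial ^ p\<close> lowers \<open>n\<close> by
      \<open>p\<close>; both sides test j + p = n.\<close>
    have shift: "\<phi> j (dact P' y) = \<phi> (j + p) y" for y
      using p by (simp add: \<phi>_def dact_mult[symmetric] power_commutes)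
    have "\<phi> j 0 = 0" by (simp add: \<phi>_def dact_0_right concom_0_right)
    then show "\<phi> j (dact (P' * T) (expb n)) = \<phi> j (dact (T * dpartial ^ p) (expb n))"
      by (auto simp: dact_mult T shift v dact_dpartial_power fps_deriv_funpow_expb dact_0_right
          le_mod_geq)
  qed
  have basis: "concom P (dact S (expb m)) (dact T (expb n)) = bdry p (expb m) (expb n)" if "m < p" for m n
  proof -
    have *: "(p - 1 - m) mod p = p - 1 - m" "(p - 1 - m) div p = 0" "p - 1 - (p - 1 - m) = m"
      using that by auto
    have "\<phi> (p - 1 - m) (v n) = bdry p (expb m) (expb n)"
      unfolding v using that * by (auto simp: bdry_expb_left jet_expb)
    then show ?thesis unfolding \<phi>_def * by (simp add: dact_1 T)
  qed
  \<comment> \<open>The arguments are infinite series, so linearity alone does not leave the basis.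
    Both sides vanish on valuation at least \<open>p\<close> and thus see finitely many
    jets.\<close>
  have basis': "concom P (dact S w) (dact T (expb n)) = bdry p w (expb n)" for w n
  proof -
    have 1: "concom P (dact S f) (dact T (expb n)) = 0" "bdry p f (expb n) = 0" if f: "val_ge (int p) f" for f
      using concom_top[OF P unitri_dact[OF S f] val_ge_nonpos[of 0 "dact T (expb n)"]]
        bdry_val_ge[OF unitri_dact[OF S f] val_ge_nonpos[of 0 "dact T (expb n)"], of p]
        bdry_val_ge[OF f val_ge_nonpos[of 0 "expb n"], of p] by simp_all
    show ?thesis
      using linfun_truncate[OF linfun_dact[OF linfun_concom(2)] 1(1), where f = w]
        linfun_truncate[OF linfun_bdry(2) 1(2), where f = w] by (simp add: basis)
  qed
  have "concom P (dact S w) (dact T z) = bdry p w z" for w z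
  proof -
    have 1: "concom P (dact S w) (dact T f) = 0" "bdry p w f = 0" if f: "val_ge (int p) f" for f
      using concom_top[OF P val_ge_nonpos[of 0 "dact S w"] unitri_dact[OF T(1) f]]
        bdry_val_ge[OF val_ge_nonpos[of 0 "dact S w"] unitri_dact[OF T(1) f], of p]
        bdry_val_ge[OF val_ge_nonpos[of 0 w] f, of p] by simp_all
    show ?thesis
      using linfun_truncate[OF linfun_dact[OF linfun_concom(1)] 1(1), where f = z]
        linfun_truncate[OF linfun_bdry(1) 1(2), where f = z] by (simp add: basis')
  qed
  then show ?thesis using T(1) comm by blast
qed

lemma sadj_cases: "sadj k P = adj P \<and> even k \<or> sadj k P = - adj P \<and> odd k"
  by (cases "even k") (simp_all add: sadj_def)

section \<open>Transposition\<close>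

text \<open>
  Comparing \<open>concom (Q * P)\<close> with \<open>concom (P * Q)\<close> relates the matrix of \<open>U\<close> to that of \<open>V\<close> up to
  the boundary term \<open>b\<close> of \<open>Q\<close>, which moves a power of $\partial^p$ from one argument to the other
  up to sign and therefore cancels.
\<close>

lemma schur_transpose:
  fixes P Q S T :: "'a::field_char_0 dsym"
  assumes P: "P \<in> D1" and Q: "Q \<in> D1" and comm: "Q * P - P * Q = dfun f"
    and S: "P * S = S * dpartial ^ p" and T: "sadj p P * T = T * dpartial ^ p"
    and QS: "Q * S = S * U" and QT: "adj Q * T = T * V"
    and pair: "\<And>w z. concom P (dact S w) (dact T z) = bdry p w z"
    and r: "r < p" and s: "s < p"
  shows "(- 1) ^ s * jet (p - 1 - s) (dact U (expb (r + p * k))) =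
    ((- 1) ^ p) ^ k * (- 1) ^ (p - 1 - r) * jet (p - 1 - r) (dact V (expb (s + p * k)))"
proof -
  define b where "b u v = concom Q (dact S u) (dact T v)" for u v
  have PS: "dact P (dact S u) = dact S ((fps_deriv ^^ p) u)" for u
    using S by (metis dact_mult dact_dpartial_power)
  have PT: "concom L u (dact (adj P) (dact T v)) = (- 1) ^ p * concom L u (dact T ((fps_deriv ^^ p) v))" for L u v
  proof -
    have "dact (sadj p P) (dact T v) = dact T ((fps_deriv ^^ p) v)"
      using T by (metis dact_mult dact_dpartial_power)
    then have "dact (adj P) (dact T v) = (if even p then 1 else - 1) * dact T ((fps_deriv ^^ p) v)"
      by (cases "even p") (auto simp: sadj_def dact_uminus eq_neg_iff_add_eq_0 neg_eq_iff_add_eq_0)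
    then show ?thesis
      by (cases "even p") (simp_all add: concom_uminus_right)
  qed
  \<comment> \<open>The products \<open>Q * P\<close> and \<open>P * Q\<close> differ by a
    multiplication operator, so their concomitants agree; both are expanded by
    \<open>concom_mult\<close>.\<close>
  have id: "bdry p (dact U u) v - bdry p u (dact V v) = b ((fps_deriv ^^ p) u) v - (- 1) ^ p * b u ((fps_deriv ^^ p) v)"
    for u v
  proof -
    have "Q * P = P * Q + dfun f" using comm by (simp add: algebra_simps)
    then have "concom (Q * P) (dact S u) (dact T v) = concom (P * Q) (dact S u) (dact T v)"
      by (simp add: concom_add concom_dfun D1_mult D1_dfun P Q)
    moreover have "dact Q (dact S u) = dact S (dact U u)" "dact (adj Q) (dact T v) = dact T (dact V v)"
      using QS QT by (metis dact_mult)+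
    ultimately show ?thesis
      by (simp add: concom_mult P Q PS PT pair b_def algebra_simps)
  qed
  have sign: "(- 1) ^ p * ((- 1) ^ p * x) = (x :: 'a)" for x
    by (cases "even p") simp_all
  have shift: "b (expb (m + p * k)) (expb n) = ((- 1) ^ p) ^ k * b (expb m) (expb (n + p * k))" for k m n
  proof (induction k arbitrary: n)
    case (Suc k)
    \<comment> \<open>Both indices inserted into \<open>id\<close> are at least \<open>p\<close>, so
      its two \<open>bdry\<close> terms vanish.\<close>
    have "b (expb (m + p * k)) (expb (n + p)) = (- 1) ^ p * b (expb (m + p * Suc k)) (expb n)"
      using id[of "expb (m + p * Suc k)" "expb (n + p)"]
      by (simp add: bdry_expb_left bdry_expb_right fps_deriv_funpow_expb)
    then have "b (expb (m + p * Suc k)) (expb n) = (- 1) ^ p * b (expb (m + p * k)) (expb (n + p))"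
      by (simp add: sign)
    then show ?case by (simp add: Suc.IH add.assoc)
  qed simp
  have b0: "b 0 v = 0" "b v 0 = 0" for v by (simp_all add: b_def dact_0_right concom_0_left concom_0_right)
  show ?thesis
  proof (cases k)
    case 0
    then show ?thesis
      using id[of "expb r" "expb s"] r s
      by (simp add: bdry_expb_left bdry_expb_right fps_deriv_funpow_expb b0)
  next
    case (Suc l)
    \<comment> \<open>With exactly one index at least \<open>p\<close>, one \<open>bdry\<close> term
      and one \<open>b\<close> term of \<open>id\<close> survive. The \<open>b\<close> terms of this
      and the next equation differ by \<open>l\<close> shifts.\<close>
    have "(- 1) ^ s * jet (p - 1 - s) (dact U (expb (r + p * k))) = b (expb (r + p * l)) (expb s)"
      using id[of "expb (r + p * k)" "expb s"] r s Suc
      by (simp add: bdry_expb_left bdry_expb_right fps_deriv_funpow_expb b0)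
    moreover have "(- 1) ^ (p - 1 - r) * jet (p - 1 - r) (dact V (expb (s + p * k))) =
        (- 1) ^ p * b (expb r) (expb (s + p * l))"
      using id[of "expb r" "expb (s + p * k)"] r s Suc
      by (simp add: bdry_expb_left bdry_expb_right fps_deriv_funpow_expb b0)
    ultimately show ?thesis by (simp add: shift Suc mult.assoc sign mult.left_commute[of _ "((- 1) ^ p) ^ l"])
  qed
qed

text \<open>Transposition matches each entry of \<open>V\<close> in a row below \<open>p\<close>
  with one entry of \<open>U\<close> in a row below \<open>p\<close>, so agreement in these rows is
  inherited.\<close>

lemma schur_transpose_jets:
  assumes "\<And>r s k. r < p \<Longrightarrow> s < p \<Longrightarrow> (- 1) ^ s * jet (p - 1 - s) (dact U (expb (r + p * k))) =
      ((- 1) ^ p) ^ k * (- 1) ^ (p - 1 - r) * jet (p - 1 - r) (dact V (expb (s + p * k)))"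
    and "\<And>r s k. r < p \<Longrightarrow> s < p \<Longrightarrow> (- 1) ^ s * jet (p - 1 - s) (dact U' (expb (r + p * k))) =
      ((- 1) ^ p) ^ k * (- 1) ^ (p - 1 - r) * jet (p - 1 - r) (dact V' (expb (s + p * k)))"
    and eq: "\<And>n i. i < p \<Longrightarrow> jet i (dact U (expb n)) = jet i (dact U' (expb n))" and i: "i < p"
  shows "jet i (dact V (expb n)) = jet i (dact V' (expb n))"
proof -
  define r s k where "r = p - 1 - i" and "s = n mod p" and "k = n div p"
  have rs: "r < p" "s < p" "p - 1 - r = i" "n = s + p * k" "p - 1 - s < p"
    using i by (auto simp: r_def s_def k_def)
  have "((- 1) ^ p) ^ k * (- 1) ^ i * jet i (dact V (expb n)) = ((- 1) ^ p) ^ k * (- 1) ^ i * jet i (dact V' (expb n))"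
    using assms(1,2)[OF rs(1,2), of k] eq[OF rs(5)] unfolding rs(3) rs(4)[symmetric] by metis
  then show ?thesis by simp
qed

text \<open>For i \<ge> p, commuting with \<open>dpartial ^ p\<close> reduces the i-th jet of the
  image of \<open>expb n\<close> to the (i - p)-th jet of the image of \<open>expb (n - p)\<close>,
  or to 0 when n < p.\<close>

lemma commutant_eq_0:
  fixes D :: "'a::field_char_0 dsym"
  assumes p: "0 < p" and comm: "D * dpartial ^ p = dpartial ^ p * D"
    and jets: "\<And>n i. i < p \<Longrightarrow> jet i (dact D (expb n)) = 0"
  shows "D = 0"
proof (rule dsym_eq_expb)
  fix n
  have "jet i (dact D (expb n)) = 0" for i
  proof (induction i arbitrary: n rule: less_induct)
    case (less i)
    show ?case
    proof (cases "i < p")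
      case False
      have "jet i (dact D (expb n)) = jet (i - p) ((fps_deriv ^^ p) (dact D (expb n)))"
        using False by (simp add: jet_deriv)
      also have "\<dots> = jet (i - p) (dact D ((fps_deriv ^^ p) (expb n)))"
        using comm by (metis dact_mult dact_dpartial_power)
      also have "\<dots> = 0"
        using less[of "i - p"] False p by (simp add: fps_deriv_funpow_expb dact_0_right jet_simps)
      finally show ?thesis .
    qed (rule jets)
  qed
  then show "dact D (expb n) = dact 0 (expb n)" by (intro fps_eq_jetI) (simp add: dact_0 jet_simps)
qed

section \<open>Homogeneous components and monic Schur operators\<close>

lemma dcoeff_hcomp_nth: "dcoeff (hcomp m P) k $ i = (if int k - int i = m then dcoeff P k $ i else 0)"
  by (simp add: hcomp.rep_eq)

lemma hcomp_diff: "hcomp m (P - Q) = hcomp m P - hcomp m Q"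
  by (rule dsym_eqI) (simp add: dcoeff_simps dcoeff_hcomp_nth)

lemma hcomp_0_1: "hcomp 0 1 = 1"
  by (rule dsym_eqI) (auto simp: dcoeff_simps dcoeff_hcomp_nth)

lemma hcomp_mult_dpartial: "hcomp m (P * dpartial) = hcomp (m - 1) P * dpartial"
  by (rule dsym_eqI) (auto simp: dcoeff_mult_dpartial dcoeff_hcomp_nth)

lemma hcomp_dpartial_mult: "hcomp m (dpartial * P) = dpartial * hcomp (m - 1) P"
  by (rule dsym_eqI) (auto simp: dcoeff_dpartial_mult dcoeff_hcomp_nth)

lemma hcomp_mult_dpartial_power:
  "hcomp m (P * dpartial ^ p) = hcomp (m - int p) P * dpartial ^ p" for P :: "'a::field_char_0 dsym"
proof (induction p arbitrary: m)
  case (Suc p)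
  show ?case
    by (simp add: power_Suc2 mult.assoc[symmetric] hcomp_mult_dpartial Suc del: power_Suc)
      (simp add: algebra_simps)
qed simp

lemma hcomp_dpartial_power_mult:
  "hcomp m (dpartial ^ p * P) = dpartial ^ p * hcomp (m - int p) P" for P :: "'a::field_char_0 dsym"
proof (induction p arbitrary: m)
  case (Suc p)
  show ?case
    by (simp add: mult.assoc hcomp_dpartial_mult Suc) (simp add: algebra_simps)
qed simp

lemma ordle_hcomp: "ordle (hcomp m P) m"
  by (auto simp: ordle_def dcoeff_hcomp_nth)

lemma jet_hcomp: "i < p \<Longrightarrow> jet i (dact (hcomp (- int p) P) (expb n)) = 0"
  by (rule jet_val_ge[OF ordle_dact[OF ordle_hcomp val_ge_expb]]) simp

lemma unitri_iff: "unitri S \<longleftrightarrow> bord S = 0 \<and> hcomp 0 S = 1" for S :: "'a::field_char_0 dsym"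
proof
  assume S: "unitri S"
  have diag: "dcoeff S k $ k = dcoeff 1 k $ k" for k
  proof (rule ccontr)
    assume "dcoeff S k $ k \<noteq> dcoeff 1 k $ k"
    then have "dcoeff (S - 1) k $ k \<noteq> 0" by (simp add: dcoeff_simps)
    then show False using S unfolding unitri_def ordle_def by fastforce
  qed
  have "ereal (real 0 - real 0) \<le> bord S"
    by (rule bord_geI) (simp add: diag dcoeff_simps)
  moreover have "bord S \<le> ereal (of_int 0)" by (rule bord_leI[OF unitri_ordle[OF S]])
  moreover have "hcomp 0 S = 1"
    by (rule dsym_eqI) (auto simp: dcoeff_hcomp_nth diag, auto simp: dcoeff_simps)
  ultimately show "bord S = 0 \<and> hcomp 0 S = 1" by (simp add: zero_ereal_def)
next
  assume *: "bord S = 0 \<and> hcomp 0 S = 1"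
  then have S: "ordle S 0" by (intro bord_leD) (simp add: zero_ereal_def)
  have diag: "dcoeff S k $ k = dcoeff 1 k $ k" for k
    using dcoeff_hcomp_nth[of 0 S k k] * by simp
  show "unitri S"
    unfolding unitri_def ordle_def
  proof (intro allI impI)
    fix k i assume nz: "dcoeff (S - 1) k $ i \<noteq> 0"
    then have "k \<noteq> i" using diag by (auto simp: dcoeff_simps)
    moreover have "int k \<le> int i + 0"
      using ordle_diff[OF S ordle_1] nz unfolding ordle_def by blast
    ultimately show "int k \<le> int i + - 1" by simp
  qed
qed

section \<open>The correspondence under the adjoint\<close>

lemma D1_sadj: "P \<in> D1 \<Longrightarrow> sadj k P \<in> D1"
  using sadj_cases[of k P] by (metis D1_adj D1_uminus)

lemma sadj_sadj: "P \<in> D1 \<Longrightarrow> sadj k (sadj k P) = P"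
  by (cases "even k") (simp_all add: sadj_def adj_uminus D1_adj adj_adj)

lemma dord_sadj: "P \<in> D1 \<Longrightarrow> dord (sadj k P) = dord P"
  using sadj_cases[of k P] by (metis dord_adj dord_uminus)

lemma bord_sadj: "P \<in> D1 \<Longrightarrow> bord (sadj k P) = bord P"
  using sadj_cases[of k P] by (metis bord_adj bord_uminus)

text \<open>The two signs multiply to -1, which compensates the reversal of products by
  \<open>adj\<close>.\<close>

lemma sadj_commutator:
  "P \<in> D1 \<Longrightarrow> Q \<in> D1 \<Longrightarrow>
    sadj (Suc p) Q * sadj p P - sadj p P * sadj (Suc p) Q = adj (Q * P - P * Q)"
  by (cases "even p") (simp_all add: sadj_def adj_diff D1_mult adj_mult)

lemma sadj_dpartial_power: "sadj p (dpartial ^ p) = dpartial ^ p"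
  by (cases "even p") (simp_all add: sadj_def adj_power D1_dpartial adj_dpartial)

lemma sadj_diff: "P \<in> D1 \<Longrightarrow> Q \<in> D1 \<Longrightarrow> sadj k (P - Q) = sadj k P - sadj k Q"
  by (simp add: sadj_def adj_diff right_diff_distrib)

lemma dcoeff_sadj_diff:
  assumes "P \<in> D1" "\<forall>k\<ge>N. dcoeff (P - dpartial ^ p) k = 0"
  shows "\<forall>k\<ge>N. dcoeff (sadj p P - dpartial ^ p) k = 0"
proof -
  have "sadj p P - dpartial ^ p = sadj p (P - dpartial ^ p)"
    by (simp add: sadj_diff assms(1) D1_power D1_dpartial sadj_dpartial_power)
  moreover have "dcoeff (sadj p (P - dpartial ^ p)) k = 0" if "k \<ge> N" for k
    using sadj_cases[of p "P - dpartial ^ p"] dcoeff_adj_eq_0[OF assms(2) that]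
    by (auto simp: dcoeff_simps)
  ultimately show ?thesis by simp
qed

section \<open>Monic and normalized operators, and their Schur operators\<close>

lemma monic_iff: "monic p P \<longleftrightarrow> (\<forall>k\<ge>p. dcoeff (P - dpartial ^ p) k = 0)"
  unfolding monic_def by (auto simp: dcoeff_simps dcoeff_dpartial_power le_less)

lemma monic_dord: assumes "monic p P" shows "dord P = p"
proof (rule antisym)
  have D: "P \<in> D1" by (rule monic_D1[OF assms])
  show "dord P \<le> p" using assms unfolding dord_le_iff[OF D] monic_def by blast
  show "p \<le> dord P"
  proof (rule ccontr)
    assume "\<not> p \<le> dord P"
    then have "dcoeff P p = 0" using dord_le_iff[OF D, of "dord P"] by simp
    then show False using assms by (simp add: monic_def)
  qed
qed

lemma normalized_monic: assumes "normalized P" shows "monic (dord P) P"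
  using assms dord_le_iff[of P "dord P"] unfolding normalized_def monic_def by blast

text \<open>Normalization becomes a degree bound on \<open>P - dpartial ^ p\<close>, the form in
  which \<open>dcoeff_sadj_diff\<close> transports it to the adjoint.\<close>

lemma normalized_iff:
  assumes "0 < p"
  shows "normalized P \<and> dord P = p \<longleftrightarrow> (\<forall>k\<ge>p - 1. dcoeff (P - dpartial ^ p) k = 0)"
proof
  assume *: "normalized P \<and> dord P = p"
  then have m: "monic p P" using normalized_monic by blast
  show "\<forall>k\<ge>p - 1. dcoeff (P - dpartial ^ p) k = 0"
  proof (intro allI impI)
    fix k assume "k \<ge> p - 1"
    then consider "k \<ge> p" | "k = p - 1" by linarith
    then show "dcoeff (P - dpartial ^ p) k = 0"
    proof cases
      case 2
      then show ?thesis
        using * assms by (auto simp: normalized_def dcoeff_simps dcoeff_dpartial_power)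
    qed (use m monic_iff in blast)
  qed
next
  assume *: "\<forall>k\<ge>p - 1. dcoeff (P - dpartial ^ p) k = 0"
  then have m: "monic p P" unfolding monic_iff by simp
  have "dcoeff (P - dpartial ^ p) (p - 1) = 0" using * by blast
  then have "dcoeff P (p - 1) = 0"
    using assms by (simp add: dcoeff_simps dcoeff_dpartial_power)
  then show "normalized P \<and> dord P = p"
    using m monic_dord[OF m] monic_D1[OF m] by (simp add: normalized_def monic_def)
qed

lemma normalized_sadj:
  assumes "normalized P" "dord P = p" "0 < p" shows "normalized (sadj p P)"
proof -
  have "P \<in> D1" using assms(1) by (simp add: normalized_def)
  moreover have "\<forall>k\<ge>p - 1. dcoeff (P - dpartial ^ p) k = 0"
    using assms normalized_iff[OF assms(3)] by blast
  ultimately show ?thesis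
    using dcoeff_sadj_diff normalized_iff[OF assms(3)] by blast
qed

lemma monic_sadj: "monic p P \<Longrightarrow> monic p (sadj p P)"
  using monic_iff dcoeff_sadj_diff monic_D1 by metis

lemma monic_symb: assumes "monic p P" shows "symb P = dpartial ^ p"
proof -
  have "ereal (real p - real 0) \<le> bord P"
    by (rule bord_geI) (use assms in \<open>simp add: monic_def\<close>)
  then have "bord P = ereal (of_int (int p))"
    using bord_leI[OF monic_ordle[OF assms]] by simp
  then have "symb P = hcomp (int p) P" by (simp add: symb_def)
  also have "\<dots> = dpartial ^ p"
  proof (rule dsym_eqI)
    fix k i
    show "dcoeff (hcomp (int p) P) k $ i = dcoeff (dpartial ^ p) k $ i"
      using assms unfolding monic_def
      by (cases k p rule: linorder_cases) (auto simp: dcoeff_hcomp_nth dcoeff_dpartial_power)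
  qed
  finally show ?thesis .
qed

text \<open>Unitriangular operators are invertible and a monic \<open>P\<close> has symbol
  \<open>dpartial ^ p\<close>, so the definition comes down to an intertwining relation free of
  inverses.\<close>

lemma monic_schur_iff:
  assumes "monic p P"
  shows "monic_schur P S \<longleftrightarrow> unitri S \<and> P * S = S * dpartial ^ p"
proof -
  have "dinv S * P * S = dpartial ^ p \<longleftrightarrow> P * S = S * dpartial ^ p" if "\<exists>T. is_dinv S T"
  proof
    assume "dinv S * P * S = dpartial ^ p"
    then have "(S * dinv S) * P * S = S * dpartial ^ p" by (simp add: mult.assoc)
    then show "P * S = S * dpartial ^ p" using dinv_mult[OF that] by simp
  next
    assume "P * S = S * dpartial ^ p"
    then have "dinv S * P * S = (dinv S * S) * dpartial ^ p" by (simp add: mult.assoc)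
    then show "dinv S * P * S = dpartial ^ p" using dinv_mult[OF that] by simp
  qed
  then show ?thesis
    unfolding monic_schur_def unitri_iff[symmetric] monic_dord[OF assms]
    using monic_D1[OF assms] monic_symb[OF assms] unitri_invertible unitri_iff by blast
qed

section \<open>The generated algebra and its rank\<close>

lemma kalg_uminus: "L \<in> kalg P Q \<Longrightarrow> - L \<in> kalg P Q"
  using kalg.mult[OF kalg.const[of "- 1"], of L] by (simp add: fps_const_neg[symmetric] dfun_uminus dfun_1 del: fps_const_neg)

lemma kalg_sadj:
  assumes "L \<in> kalg A B" "A \<in> D1" "B \<in> D1"
  shows "L \<in> D1 \<and> adj L \<in> kalg (sadj k A) (sadj l B)"
  using assms
proof (induction rule: kalg.induct)
  case left
  have "adj A = sadj k A \<or> adj A = - sadj k A" using sadj_cases[of k A] by auto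
  then show ?case using left kalg_uminus kalg.left by metis
next
  case right
  have "adj B = sadj l B \<or> adj B = - sadj l B" using sadj_cases[of l B] by auto
  then show ?case using right kalg_uminus kalg.right by metis
qed (simp_all add: adj_dfun adj_add adj_mult D1_dfun D1_add D1_mult kalg.intros)

lemma krank_sadj:
  assumes "A \<in> D1" "B \<in> D1" shows "krank (sadj k A) (sadj l B) = krank A B"
proof -
  have "dord ` kalg A B \<subseteq> dord ` kalg (sadj k A) (sadj l B)" if "A \<in> D1" "B \<in> D1" for A B :: "'a dsym"
  proof (rule image_subsetI)
    fix L assume "L \<in> kalg A B"
    then have "L \<in> D1" "adj L \<in> kalg (sadj k A) (sadj l B)" using kalg_sadj that by blast+
    then show "dord L \<in> dord ` kalg (sadj k A) (sadj l B)" by (metis dord_adj imageI)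
  qed
  from this[OF assms] this[of "sadj k A" "sadj l B"]
  have "dord ` kalg (sadj k A) (sadj l B) = dord ` kalg A B"
    using assms by (simp add: D1_sadj sadj_sadj)
  then show ?thesis by (simp add: krank_def)
qed

text \<open>A normalized operator of degree 0 is 1, which commutes with everything.\<close>

lemma string_solution_dord: assumes "string_solution P Q" shows "0 < dord P"
proof (rule ccontr)
  assume "\<not> 0 < dord P"
  then have "monic 0 P" using assms normalized_monic[of P] by (simp add: string_solution_def)
  then have "P = 1"
    by (intro dsym_coeff_eqI) (auto simp: monic_def dcoeff_simps)
  then show False using assms by (simp add: string_solution_def)
qed

lemma string_solution_sadj:
  assumes "string_solution P Q" shows "string_solution (sadj (dord P) P) (sadj (Suc (dord P)) Q)"
  using assms string_solution_dord[OF assms] sadj_commutator[of P Q "dord P"]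
  by (simp add: string_solution_def D1_sadj normalized_sadj adj_1)

lemma commuting_pair_sadj:
  assumes "commuting_pair P Q" "0 < dord P"
  shows "commuting_pair (sadj (dord P) P) (sadj (Suc (dord P)) Q)"
  using assms sadj_commutator[of P Q "dord P"]
  by (simp add: commuting_pair_def D1_sadj normalized_sadj adj_0)

lemma corr_rel_sadj:
  assumes PQ: "string_solution P Q" and p: "dord P = p" and corr: "corr_rel P Q A B"
  shows "corr_rel (sadj p P) (sadj (Suc p) Q) (sadj p A) (sadj (Suc p) B)"
proof -
  have p0: "0 < p" using string_solution_dord[OF PQ] p by simp
  have D: "P \<in> D1" "Q \<in> D1" "A \<in> D1" "B \<in> D1" and AB: "commuting_pair A B"
    and ord: "dord A = p" "dord B = dord Q"
    using PQ corr p by (auto simp: string_solution_def corr_rel_def commuting_pair_def)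
  have P: "monic p P" and A: "monic p A"
    using PQ AB normalized_monic[of P] normalized_monic[of A] p ord
    by (auto simp: string_solution_def commuting_pair_def)
  obtain S S' where "monic_schur P S" "monic_schur A S'"
    and conj: "dinv S' * B * S' = dinv S * Q * S - hcomp (- int p) (dinv S * Q * S)"
    using corr unfolding corr_rel_def p by blast
  then have S: "unitri S" "P * S = S * dpartial ^ p" and S': "unitri S'" "A * S' = S' * dpartial ^ p"
    using monic_schur_iff P A by blast+
  obtain T where T: "unitri T" "sadj p P * T = T * dpartial ^ p"
      "\<And>w z. concom P (dact S w) (dact T z) = bdry p w z"
    using dual_schur[OF p0 P S(1) monic_sadj[OF P]] by blast
  obtain T' where T': "unitri T'" "sadj p A * T' = T' * dpartial ^ p"
      "\<And>w z. concom A (dact S' w) (dact T' z) = bdry p w z"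
    using dual_schur[OF p0 A S'(1) monic_sadj[OF A]] by blast
  have inv: "X * dinv X = 1" "dinv X * X = 1" if "unitri X" for X :: "'a dsym"
    using dinv_mult[OF unitri_invertible[OF that]] .
  have conj_eq: "L * X = X * (dinv X * L * X)" if "unitri X" for L X :: "'a dsym"
    using inv(1)[OF that] by (metis mult.assoc mult_1_left)
  let ?R = "dinv T * adj Q * T" and ?R' = "dinv T' * adj B * T'"
  let ?U = "dinv S * Q * S" and ?U' = "dinv S' * B * S'"
  have jets_R: "jet i (dact ?R (expb n)) = jet i (dact ?R' (expb n))" if "i < p" for i n
  proof (rule schur_transpose_jets[OF _ _ _ that])
    show "jet i (dact ?U (expb n)) = jet i (dact ?U' (expb n))" if "i < p" for i n
      using jet_hcomp[OF that] by (simp add: conj dact_diff jet_simps)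
    show "(- 1) ^ s * jet (p - 1 - s) (dact ?U (expb (r + p * k))) =
      ((- 1) ^ p) ^ k * (- 1) ^ (p - 1 - r) * jet (p - 1 - r) (dact ?R (expb (s + p * k)))"
      if "r < p" "s < p" for r s k
      using PQ schur_transpose[OF D(1,2) _ S(2) T(2) conj_eq[OF S(1)] conj_eq[OF T(1)] T(3) that, of 1]
      by (simp add: string_solution_def dfun_1)
    show "(- 1) ^ s * jet (p - 1 - s) (dact ?U' (expb (r + p * k))) =
      ((- 1) ^ p) ^ k * (- 1) ^ (p - 1 - r) * jet (p - 1 - r) (dact ?R' (expb (s + p * k)))"
      if "r < p" "s < p" for r s k
      using AB schur_transpose[OF D(3,4) _ S'(2) T'(2) conj_eq[OF S'(1)] conj_eq[OF T'(1)] T'(3) that, of 0]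
      by (simp add: commuting_pair_def dfun_0)
  qed
  let ?V = "dinv T * sadj (Suc p) Q * T" and ?V' = "dinv T' * sadj (Suc p) B * T'"
  have V: "?V = - ((- 1) ^ p * ?R)" "?V' = - ((- 1) ^ p * ?R')"
    by (cases "even p"; simp add: sadj_def)+
  have jets_V: "jet i (dact ?V (expb n)) = jet i (dact ?V' (expb n))" if "i < p" for i n
    unfolding V using jets_R[OF that] by (cases "even p") (simp_all add: dact_uminus jet_simps)
  have commutator: "(dinv X * M * X) * dpartial ^ p - dpartial ^ p * (dinv X * M * X) = dinv X * (M * L - L * M) * X"
    if X: "unitri X" and L: "L * X = X * dpartial ^ p" for X L M :: "'a dsym"
  proof -
    have "dinv X * L = dpartial ^ p * dinv X"
    proof -
      have "dinv X * L * (X * dinv X) = dinv X * (X * dpartial ^ p) * dinv X"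
        using L by (metis mult.assoc)
      then show ?thesis using inv[OF X] by (simp add: mult.assoc[symmetric])
    qed
    then have "dpartial ^ p * (dinv X * M * X) = dinv X * (L * M) * X" by (metis mult.assoc)
    moreover have "(dinv X * M * X) * dpartial ^ p = dinv X * (M * L) * X" using L by (metis mult.assoc)
    ultimately show ?thesis by (simp add: right_diff_distrib left_diff_distrib)
  qed
  have V_string: "?V * dpartial ^ p - dpartial ^ p * ?V = 1"
    using commutator[OF T(1,2), of "sadj (Suc p) Q"] string_solution_sadj[OF PQ] inv(2)[OF T(1)]
    by (simp add: string_solution_def p)
  \<comment> \<open>The commutator with \<open>dpartial ^ p\<close> raises degrees by
    \<open>p\<close>, so its degree-zero part comes from \<open>hcomp (- int p) ?V\<close> alone.
    This component therefore carries the whole commutator 1, and removing it leaves an operator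
    commuting with \<open>dpartial ^ p\<close>.\<close>
  then have "hcomp 0 (?V * dpartial ^ p - dpartial ^ p * ?V) = 1" by (simp add: hcomp_0_1)
  then have hV: "hcomp (- int p) ?V * dpartial ^ p - dpartial ^ p * hcomp (- int p) ?V = 1"
    by (simp add: hcomp_diff hcomp_mult_dpartial_power hcomp_dpartial_power_mult)
  have V'_comm: "?V' * dpartial ^ p - dpartial ^ p * ?V' = 0"
    using commutator[OF T'(1,2), of "sadj (Suc p) B"] commuting_pair_sadj[OF AB] p0
    by (simp add: commuting_pair_def ord)
  have "?V' - (?V - hcomp (- int p) ?V) = 0"
  proof (rule commutant_eq_0[OF p0])
    have "(?V' - (?V - hcomp (- int p) ?V)) * dpartial ^ p - dpartial ^ p * (?V' - (?V - hcomp (- int p) ?V)) =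
        (?V' * dpartial ^ p - dpartial ^ p * ?V') - (?V * dpartial ^ p - dpartial ^ p * ?V) +
        (hcomp (- int p) ?V * dpartial ^ p - dpartial ^ p * hcomp (- int p) ?V)"
      by (simp add: left_diff_distrib right_diff_distrib)
    also have "\<dots> = 0" unfolding V_string hV V'_comm by simp
    finally show "(?V' - (?V - hcomp (- int p) ?V)) * dpartial ^ p = dpartial ^ p * (?V' - (?V - hcomp (- int p) ?V))"
      by simp
    show "jet i (dact (?V' - (?V - hcomp (- int p) ?V)) (expb n)) = 0" if "i < p" for n i
      using jets_V[OF that] jet_hcomp[OF that] by (simp add: dact_diff jet_simps)
  qed
  then have final: "?V' = ?V - hcomp (- int p) ?V" by simp
  have "monic_schur (sadj p P) T" "monic_schur (sadj p A) T'"
    using monic_schur_iff monic_sadj P A T T' by blast+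
  then show ?thesis
    using final corr commuting_pair_sadj[OF AB] p0 D ord p
    unfolding corr_rel_def by (simp add: dord_sadj krank_sadj) blast
qed

section \<open>Head-chopping sequences of the adjoint pair\<close>

lemma good_chopping_exponent:
  assumes "good_chopping P Q I ns ms eps" "i < I" shows "0 < ns i"
proof (rule ccontr)
  assume "\<not> 0 < ns i"
  have "bord (chop P Q ns ms eps (Suc i)) < bord (chop P Q ns ms eps i ^ ns i)"
    "ereal (real (dord (chop P Q ns ms eps (Suc i)))) = bord (chop P Q ns ms eps (Suc i))"
    using assms unfolding good_chopping_def by (blast, metis Suc_leI)
  \<comment> \<open>A zeroth power is 1, of order 0; the next operator would then have negative
    order, yet its order equals a degree.\<close>
  moreover have "bord (chop P Q ns ms eps i ^ ns i) \<le> ereal (of_int 0)"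
    using bord_leI[OF ordle_1] \<open>\<not> 0 < ns i\<close> by simp
  ultimately show False by (metis ereal_less_eq(3) le_less_trans not_le of_int_0 of_nat_0_le_iff)
qed

lemma D1_chop: "P \<in> D1 \<Longrightarrow> Q \<in> D1 \<Longrightarrow> chop P Q ns ms eps i \<in> D1"
  by (induction i) (simp_all add: D1_diff D1_mult D1_power D1_dfun)

text \<open>Stage \<open>i\<close> of the adjoint sequence is the adjoint of stage \<open>i\<close>
  up to the sign with exponent \<open>e i\<close>. The two terms of the next stage may acquire
  different signs, and the discrepancy is absorbed into \<open>eps'\<close> by an
  \<open>ns i\<close>-th root, available over an algebraically closed field.\<close>

lemma good_chopping_sadj:
  fixes P Q :: "'a::{alg_closed_field, field_char_0} dsym"
  assumes D: "P \<in> D1" "Q \<in> D1" and good: "good_chopping P Q I ns ms eps"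
  shows "\<exists>eps'. good_chopping (sadj k P) (sadj l Q) I ns ms eps'"
proof -
  let ?c = "chop P Q ns ms eps"
  define e where "e = rec_nat l (\<lambda>i n. n * ns i)"
  have e: "e 0 = l" "e (Suc i) = e i * ns i" for i by (simp_all add: e_def)
  have "\<exists>y. i < I \<longrightarrow> y ^ ns i = (- 1) ^ (e (Suc i) + k * ms i) * eps i ^ ns i" for i
    using nth_root_exists[of "ns i"] good_chopping_exponent[OF good, of i] by blast
  then obtain eps' where eps': "\<And>i. i < I \<Longrightarrow> eps' i ^ ns i = (- 1) ^ (e (Suc i) + k * ms i) * eps i ^ ns i"
    by metis
  let ?c' = "chop (sadj k P) (sadj l Q) ns ms eps'"
  have cD: "?c i \<in> D1" for i using D by (rule D1_chop)
  have power: "sadj j L ^ n = sadj (j * n) (L ^ n)" if "L \<in> D1" for j n and L :: "'a dsym"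
    using that by (cases "even j"; cases "even n") (simp_all add: sadj_def adj_power)
  have c': "?c' i = sadj (e i) (?c i)" if "i \<le> I" for i
    using that
  proof (induction i)
    case (Suc i)
    have "dfun (fps_const (eps' i ^ ns i)) * sadj k P ^ ms i =
        sadj (e (Suc i)) (dfun (fps_const (eps i ^ ns i)) * P ^ ms i)"
    proof -
      have "adj (dfun (fps_const (eps i ^ ns i)) * P ^ ms i) = dfun (fps_const (eps i ^ ns i)) * adj (P ^ ms i)"
        using D by (simp add: adj_mult D1_dfun D1_power adj_dfun dsym_scalar_commute)
      moreover have "dfun (fps_const (- 1)) = (- 1 :: 'a dsym)"
        by (metis dfun_1 dfun_uminus fps_const_1_eq_1 fps_const_neg)
      then have "dfun (fps_const ((- 1) ^ j * x)) = (- 1) ^ j * dfun (fps_const x)" for j and x :: 'a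
        by (cases "even j") (simp_all add: dfun_uminus fps_const_neg[symmetric] del: fps_const_neg)
      moreover have "(- 1) ^ (j + m) * x * ((- 1) ^ m * y) = (- 1) ^ j * (x * y)" for j m and x y :: "'a dsym"
        by (cases "even j"; cases "even m") simp_all
      ultimately show ?thesis
        using Suc.prems D by (simp add: eps' power[OF D(1)]) (simp add: sadj_def)
    qed
    then show ?case
      using Suc by (simp add: power cD e sadj_diff D1_power D1_mult D1_dfun D)
  qed (simp add: e)
  have "bord (?c' i) = bord (?c i)" "dord (?c' i) = dord (?c i)"
    "bord (?c' i ^ n) = bord (?c i ^ n)" if "i \<le> I" for i n
    using that by (simp_all add: c' power cD D1_power bord_sadj dord_sadj)
  moreover from this(2) have "seqgcd (sadj k P) ?c' j = seqgcd P ?c j" if "j \<le> Suc I" for j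
    using that unfolding seqgcd_def dord_sadj[OF D(1)]
    by (intro arg_cong[of _ _ Gcd] arg_cong[of _ _ "insert _"] image_cong) auto
  ultimately have "good_chopping (sadj k P) (sadj l Q) I ns ms eps'"
    using good unfolding good_chopping_def by (simp del: chop.simps)
  then show ?thesis by blast
qed

lemma admissible_sadj:
  fixes P Q :: "'a::{alg_closed_field, field_char_0} dsym"
  assumes "admissible P Q"
  shows "admissible (sadj (dord P) P) (sadj (Suc (dord P)) Q)"
proof -
  have PQ: "string_solution P Q" using assms by (simp add: admissible_def)
  then have D: "P \<in> D1" "Q \<in> D1" by (simp_all add: string_solution_def)
  have "\<exists>I ns ms eps. good_chopping (sadj (dord P) P) (sadj (Suc (dord P)) Q) I ns ms eps"
    using assms good_chopping_sadj[OF D] unfolding admissible_def by blast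
  then show ?thesis
    using assms string_solution_sadj[OF PQ]
    unfolding admissible_def dord_sadj[OF D(1)] dord_sadj[OF D(2)] bord_sadj[OF D(2)] by simp
qed

lemma corresponding_pair_sadj:
  fixes P Q :: "'a::field_char_0 dsym"
  assumes PQ: "string_solution P Q" and p: "dord P = p" and corr: "corresponding_pair P Q P' Q'"
  shows "corresponding_pair (sadj p P) (sadj (Suc p) Q) (sadj p P') (sadj (Suc p) Q')"
  unfolding corresponding_pair_def
proof (intro allI iffI)
  fix A B assume *: "corr_rel (sadj p P) (sadj (Suc p) Q) A B"
  have D: "P \<in> D1" "Q \<in> D1" "A \<in> D1" "B \<in> D1"
    using PQ * by (auto simp: string_solution_def corr_rel_def commuting_pair_def)
  have "string_solution (sadj p P) (sadj (Suc p) Q)" "dord (sadj p P) = p"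
    using string_solution_sadj[OF PQ] D p by (simp_all add: dord_sadj)
  from corr_rel_sadj[OF this *] have "corr_rel P Q (sadj p A) (sadj (Suc p) B)"
    using D by (simp add: sadj_sadj)
  then have "sadj p A = P'" "sadj (Suc p) B = Q'"
    using corr unfolding corresponding_pair_def by blast+
  then show "A = sadj p P' \<and> B = sadj (Suc p) Q'" using D sadj_sadj by metis
next
  fix A B assume "A = sadj p P' \<and> B = sadj (Suc p) Q'"
  then show "corr_rel (sadj p P) (sadj (Suc p) Q) A B"
    using corr_rel_sadj[OF PQ p] corr unfolding corresponding_pair_def by blast
qed

theorem proposition5p1:
  fixes P Q P' Q' :: "'a::{alg_closed_field, field_char_0} dsym"
  assumes "admissible P Q"
    and "corresponding_pair P Q P' Q'"
  shows "(even (dord P) \<longrightarrow>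
            admissible (adj P) (- adj Q) \<and>
            corresponding_pair (adj P) (- adj Q) (adj P') (- adj Q')) \<and>
         (odd (dord P) \<longrightarrow>
            admissible (- adj P) (adj Q) \<and>
            corresponding_pair (- adj P) (adj Q) (- adj P') (adj Q'))"
proof -
  have "string_solution P Q" using assms(1) by (simp add: admissible_def)
  then show ?thesis
    using admissible_sadj[OF assms(1)] corresponding_pair_sadj[OF _ refl assms(2)]
    by (cases "even (dord P)") (simp_all add: sadj_def)
qed

end
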